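(* Let $X_n^H:=\log|\det W_n^H|-\mu_n^H$ with $\mu_n^H=\frac12\log2\pi-\frac n2+\frac n2\log n$. For every real sequence $y=y_n$ with $y=o(\sqrt{\log n})$, as $n\to\infty$, $$\mathbb{P}\left[X_n^H\ge y\sqrt{\tfrac12\log\left(\tfrac n2\right)}\right]=\mathbb{P}[\mathcal N(0,1)\ge y]\,(1+o(1)).$$
   Context: $W_n^H$ is a random $n\times n$ Hermitian matrix of the Gaussian Unitary Ensemble, normalized so that its eigenvalues have joint density on $\mathbb{R}^n$ proportional to $\prod_{1\le j<k\le n}|\lambda_k-\lambda_j|^2\prod_{k=1}^n e^{-\lambda_k^2/2}$. $\mathcal N(0,1)$ denotes a standard normal random variable. *)

theory Defs
  imports
    "HOL-Probability.Probability"
    "HOL-Library.Landau_Symbols"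
    "HOL-Combinatorics.Permutations"
    "Jordan_Normal_Form.Schur_Decomposition"
begin

text \<open>
  Matrices are those of \<open>Jordan_Normal_Form\<close>, because the size \<open>n\<close> tends to infinity.
\<close>

definition hermitian :: "complex mat \<Rightarrow> bool" where
  "hermitian A \<longleftrightarrow> mat_adjoint A = A"

text \<open>
  A Hermitian matrix is determined by \<open>n\<^sup>2\<close> real coordinates: the pair \<open>(i, j)\<close> with
  \<open>i \<le> j\<close> stands for \<open>Re A\<^sub>i\<^sub>j\<close>, and \<open>(i, j)\<close> with \<open>j < i\<close> for
  \<open>Im A\<^sub>i\<^sub>j = - Im A\<^sub>j\<^sub>i\<close>.
\<close>

definition herm_coord :: "nat \<times> nat \<Rightarrow> complex mat \<Rightarrow> real" where
  "herm_coord = (\<lambda>(i, j) A. if i \<le> j then Re (A $$ (i, j)) else Im (A $$ (i, j)))"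

text \<open>
  Gaussian Unitary Ensemble with scale \<open>\<sigma>\<close>: a Hermitian matrix whose diagonal entries are
  \<open>N(0, \<sigma>\<^sup>2)\<close>, whose entries above the diagonal have real and imaginary parts distributed
  as \<open>N(0, \<sigma>\<^sup>2/2)\<close>, with all these variables independent. The second parameter of
  \<open>normal_density\<close> is the standard deviation. The scale is fixed by the eigenvalue density,
  see \<open>normalized_GUE\<close> below.
\<close>

definition GUE :: "'a measure \<Rightarrow> nat \<Rightarrow> real \<Rightarrow> ('a \<Rightarrow> complex mat) \<Rightarrow> bool" where
  "GUE M n \<sigma> W \<longleftrightarrow>
     prob_space M \<and> \<sigma> > 0 \<and>
     (\<forall>\<omega>\<in>space M. W \<omega> \<in> carrier_mat n n \<and> hermitian (W \<omega>)) \<and>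
     prob_space.indep_vars M (\<lambda>_. borel) (\<lambda>p \<omega>. herm_coord p (W \<omega>)) ({..<n} \<times> {..<n}) \<and>
     (\<forall>i<n. \<forall>j<n. distributed M lborel (\<lambda>\<omega>. herm_coord (i, j) (W \<omega>))
        (normal_density 0 (if i = j then \<sigma> else \<sigma> / sqrt 2)))"

text \<open>
  The eigenvalues in increasing order, repeated according to algebraic multiplicity. For
  Hermitian matrices all roots of the characteristic polynomial are real, so \<open>Re\<close> only
  changes the type.
\<close>

definition eigenvalue_list :: "complex mat \<Rightarrow> real list" where
  "eigenvalue_list A = sorted_list_of_multiset (image_mset Re (proots (char_poly A)))"

definition gue_weight :: "nat \<Rightarrow> (nat \<Rightarrow> real) \<Rightarrow> real" where
  "gue_weight n x = (\<Prod>k<n. \<Prod>j<k. \<bar>x k - x j\<bar>\<^sup>2) * (\<Prod>k<n. exp (- (x k)\<^sup>2 / 2))"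

text \<open>
  A density on all of \<open>\<real>\<^sup>n\<close> that is symmetric in its arguments refers to the eigenvalues
  without a distinguished order. This is made precise by labelling them with a uniformly
  random permutation independent of the matrix.
\<close>

definition eigenvalues_have_density ::
    "'a measure \<Rightarrow> nat \<Rightarrow> ('a \<Rightarrow> complex mat) \<Rightarrow> ((nat \<Rightarrow> real) \<Rightarrow> real) \<Rightarrow> bool" where
  "eigenvalues_have_density M n W f \<longleftrightarrow>
     distributed (M \<Otimes>\<^sub>M measure_pmf (pmf_of_set {\<pi>. \<pi> permutes {..<n}}))
       (\<Pi>\<^sub>M i\<in>{..<n}. lborel)
       (\<lambda>(\<omega>, \<pi>). \<lambda>i\<in>{..<n}. eigenvalue_list (W \<omega>) ! \<pi> i)
       (\<lambda>x. ennreal (f x))"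

definition normalized_GUE :: "'a measure \<Rightarrow> nat \<Rightarrow> ('a \<Rightarrow> complex mat) \<Rightarrow> bool" where
  "normalized_GUE M n W \<longleftrightarrow>
     (\<exists>\<sigma>. GUE M n \<sigma> W) \<and>
     (\<exists>c>0. eigenvalues_have_density M n W (\<lambda>x. c * gue_weight n x))"

definition gue_mu :: "nat \<Rightarrow> real" where
  "gue_mu n = 1/2 * ln (2 * pi) - real n / 2 + real n / 2 * ln (real n)"

text \<open>
  On the null event that the determinant vanishes, \<open>ln 0 = 0\<close> replaces minus infinity.
\<close>

definition log_det_centered :: "nat \<Rightarrow> complex mat \<Rightarrow> real" where
  "log_det_centered n A = ln (cmod (Determinant.det A)) - gue_mu n"

end

theory Submission
  imports Defs "HOL-Real_Asymp.Real_Asymp"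
begin

text \<open>
  Let \<open>s\<^sup>2 = ln (n/2) / 2\<close> and let \<open>X\<close> be the centred log-determinant. The proof computes the moment
  generating function of \<open>X\<close> in closed form and reads the tail off from it.

  The determinant of a Hermitian matrix is the product of its eigenvalues, so \<open>E |det W|\<^sup>z\<close> is the
  integral of \<open>\<Prod> |x\<^sub>i|\<^sup>z\<close> against a squared Vandermonde determinant times a product weight. Expanding
  both determinants over permutations turns this integral into \<open>n!\<close> times the Hankel determinant of
  the moments of \<open>|x|\<^sup>z exp (- x\<^sup>2/2)\<close>, and row operations based on \<open>\<Gamma>(w + 1) = w \<Gamma>(w)\<close> evaluate
  the latter as a product of Gamma values (\<open>det_hankel\<close>, \<open>normalized_GUE_mgf\<close>). The outcome says that
  \<open>|det W|\<close> has the Mellin transform of a product of independent chi variables with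
  \<open>2 \<lfloor>k/2\<rfloor> + 1\<close> degrees of freedom, \<open>k = 1, ..., n\<close>.

  Consequently \<open>E exp (z X) = exp (s\<^sup>2 z\<^sup>2/2 + G\<^sub>n(z))\<close>, where the second derivative of \<open>G\<^sub>n\<close> is a sum of
  trigamma values minus \<open>s\<^sup>2\<close>. Since \<open>\<psi>'(a) \<approx> 1/a\<close>, that sum is a harmonic sum which \<open>s\<^sup>2\<close>
  cancels up to a bounded error; and \<open>G\<^sub>n\<close> vanishes at 0 and is bounded at 2, where
  \<open>E |det W|\<^sup>2\<close> is an explicit product of odd numbers. So \<open>G\<^sub>n\<close> is Lipschitz near 0 in the right half
  plane, uniformly in \<open>n\<close> (\<open>gue_rest_lipschitz\<close>). This is mod-Gaussian convergence in the form that is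
  needed here.

  For \<open>y \<ge> 0\<close> the tail is treated by exponential tilting with \<open>h = y/s\<close>, which tends to 0 by the
  assumption on \<open>y\<close>. The tilted and rescaled law has a characteristic function at distance at most
  \<open>(K/s) |t| / (1 + t\<^sup>2)\<close> from the Gaussian one (\<open>gue_tilted_char_close\<close>), and this is integrable after
  division by \<open>|t|\<close>, so that Levy inversion bounds the distance of the distribution functions by \<open>K/s\<close>
  (\<open>char_close_imp_cdf_close\<close>). Tilting expresses both \<open>P (X \<ge> y s)\<close> and \<open>P (N \<ge> y)\<close> by integrals of
  \<open>exp (- y u)\<close> over \<open>u \<ge> 0\<close>. For the Gaussian law this integral is at least a constant times
  \<open>1 / (1 + y)\<close>, hence replacing one law by the other costs a relative error of order
  \<open>(1 + y) / s \<rightarrow> 0\<close>; the only other discrepancy is the factor \<open>exp (G\<^sub>n(h)) \<rightarrow> 1\<close>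
  (\<open>tilted_tail_ratio\<close>). For \<open>y < 0\<close> the Gaussian tail is bounded below and the estimate of the
  distribution functions for \<open>h = 0\<close> suffices.
\<close>

section \<open>Determinants and eigenvalues of Hermitian matrices\<close>

lemma hermitian_entry:
  assumes A: "A \<in> carrier_mat n n" "hermitian A" and ij: "i < n" "j < n"
  shows "A $$ (i, j) = cnj (A $$ (j, i))"
proof -
  have "mat_adjoint A $$ (i, j) = cnj (A $$ (j, i))"
    using A(1) ij by (simp add: mat_adjoint_def mat_of_rows_def)
  thus ?thesis using A(2) by (simp add: hermitian_def)
qed

text \<open>
  For an eigenvector \<open>v\<close> the quadratic form \<open>v\<^sup>* A v\<close> equals its own conjugate and is \<open>a\<close> times the
  squared length of \<open>v\<close>.
\<close>

lemma hermitian_char_poly_root_real: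
  assumes A: "A \<in> carrier_mat n n" "hermitian A" and a: "poly (char_poly A) a = 0"
  shows "a \<in> \<real>"
proof -
  have "eigenvalue A a" using a eigenvalue_root_char_poly[OF A(1)] by simp
  then obtain v where v: "v \<in> carrier_vec n" "v \<noteq> 0\<^sub>v n" "A *\<^sub>v v = a \<cdot>\<^sub>v v"
    using A(1) by (auto simp: eigenvalue_def eigenvector_def)
  define q where "q = (\<Sum>i<n. \<Sum>j<n. A $$ (i, j) * v $ j * cnj (v $ i))"
  define N where "N = (\<Sum>i<n. (cmod (v $ i))\<^sup>2)"
  have "(\<Sum>j<n. A $$ (i, j) * v $ j) = a * v $ i" if "i < n" for i
  proof -
    have "(A *\<^sub>v v) $ i = (\<Sum>j<n. A $$ (i, j) * v $ j)"
      using that A(1) v(1) by (simp add: scalar_prod_def atLeast0LessThan)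
    moreover have "(a \<cdot>\<^sub>v v) $ i = a * v $ i" using that v(1) by simp
    ultimately show ?thesis using v(3) by simp
  qed
  hence "q = (\<Sum>i<n. a * v $ i * cnj (v $ i))"
    unfolding q_def by (simp add: sum_distrib_right[symmetric])
  also have "\<dots> = a * of_real N"
    unfolding N_def of_real_sum sum_distrib_left
    by (intro sum.cong refl) (simp only: complex_norm_square mult.assoc)
  finally have q: "q = a * of_real N" .
  have "cnj q = (\<Sum>i<n. \<Sum>j<n. cnj (A $$ (i, j)) * cnj (v $ j) * v $ i)"
    by (simp add: q_def)
  also have "\<dots> = (\<Sum>i<n. \<Sum>j<n. A $$ (j, i) * v $ i * cnj (v $ j))"
  proof (intro sum.cong refl)
    fix i j assume "i \<in> {..<n}" "j \<in> {..<n}"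
    hence "A $$ (j, i) = cnj (A $$ (i, j))" by (intro hermitian_entry[OF A]) auto
    thus "cnj (A $$ (i, j)) * cnj (v $ j) * v $ i = A $$ (j, i) * v $ i * cnj (v $ j)"
      by (simp only: mult_ac)
  qed
  also have "\<dots> = q" unfolding q_def by (rule sum.swap)
  finally have cq: "cnj q = q" .
  have "N \<noteq> 0"
  proof
    assume "N = 0"
    hence "\<forall>i<n. v $ i = 0" unfolding N_def by (subst (asm) sum_nonneg_eq_0_iff) auto
    hence "v = 0\<^sub>v n" using v(1) by (intro eq_vecI) auto
    thus False using v(2) by simp
  qed
  hence "cnj a = a" using cq unfolding q by simp
  thus ?thesis by (simp add: Reals_cnj_iff)
qed

lemma hermitian_abs_det:
  assumes A: "A \<in> carrier_mat n n" "hermitian A"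
  shows "length (eigenvalue_list A) = n"
    and "cmod (Determinant.det A) = (\<Prod>i<n. \<bar>eigenvalue_list A ! i\<bar>)"
proof -
  obtain as where as: "char_poly A = (\<Prod>a\<leftarrow>as. [:- a, 1:])" "length as = n"
    using char_poly_factorized[OF A(1)] by blast
  have "proots (\<Prod>a\<leftarrow>xs. [:- a, 1:]) = mset xs" for xs :: "complex list"
  proof (induction xs)
    case (Cons a xs)
    have "(\<Prod>a\<leftarrow>xs. [:- a, 1:]) \<noteq> 0" by (auto simp: prod_list_zero_iff)
    thus ?case using Cons by (simp add: proots_mult del: mult_pCons_left)
  qed simp
  hence ms: "mset (eigenvalue_list A) = mset (map Re as)"
    by (simp add: eigenvalue_list_def as(1))
  show len: "length (eigenvalue_list A) = n"
    using mset_eq_length[OF ms] as(2) by simp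
  have re: "of_real (Re a) = a" if "a \<in> set as" for a
  proof -
    have "poly (char_poly A) a = 0"
      using that unfolding as(1) by (induction as) (auto simp: poly_prod_list)
    from hermitian_char_poly_root_real[OF A this] show ?thesis by simp
  qed
  have "cmod (Determinant.det A) = cmod (poly (char_poly A) 0)"
  proof -
    have "poly (char_poly A) 0 = Determinant.det (- char_matrix A 0)" by (rule char_poly_matrix[OF A(1)])
    also have "- char_matrix A 0 = (-1) \<cdot>\<^sub>m A"
      using A(1) by (intro eq_matI) (auto simp: char_matrix_def)
    finally have "poly (char_poly A) 0 = (-1) ^ n * Determinant.det A" using A(1) by simp
    thus ?thesis by (simp add: norm_mult norm_power)
  qed
  also have "poly (char_poly A) 0 = (\<Prod>a\<leftarrow>as. - a)" unfolding as(1) by (simp add: poly_prod_list o_def)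
  also have "cmod (\<Prod>a\<leftarrow>as. - a) = (\<Prod>a\<leftarrow>as. cmod a)"
    by (induction as) (auto simp: norm_mult)
  also have "\<dots> = (\<Prod>x\<leftarrow>map Re as. \<bar>x\<bar>)"
    unfolding map_map o_def
    by (rule arg_cong[where f = prod_list], rule map_cong[OF refl]) (metis re norm_of_real)
  also have "\<dots> = prod_mset (image_mset abs (mset (map Re as)))" by (metis mset_map prod_mset_prod_list)
  also have "\<dots> = (\<Prod>x\<leftarrow>eigenvalue_list A. \<bar>x\<bar>)" unfolding ms[symmetric] by (metis mset_map prod_mset_prod_list)
  also have "\<dots> = (\<Prod>i<n. \<bar>eigenvalue_list A ! i\<bar>)"
    using len by (simp add: prod.list_conv_set_nth atLeast0LessThan)
  finally show "cmod (Determinant.det A) = (\<Prod>i<n. \<bar>eigenvalue_list A ! i\<bar>)" .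
qed

section \<open>Vandermonde determinants and sums over pairs of permutations\<close>

text \<open>
  Multiplying by the unitriangular matrix of the coefficients of the Newton polynomials
  \<open>\<Prod>l<j. (t - x l)\<close> replaces the monomials by these polynomials, and the product matrix is triangular
  because the \<open>j\<close>-th of them vanishes at \<open>x i\<close> for \<open>i < j\<close>.
\<close>

lemma vandermonde_det:
  fixes x :: "nat \<Rightarrow> 'a :: idom"
  shows "Determinant.det (mat n n (\<lambda>(i, j). x i ^ j)) = (\<Prod>k<n. \<Prod>j<k. (x k - x j))"
proof -
  define N where "N j = (\<Prod>l<j. [:- x l, 1:])" for j
  have monic': "lead_coeff (N j) = 1 \<and> degree (N j) = j" for j
  proof (induction j)
    case (Suc j)
    have N: "N (Suc j) = N j * [:- x j, 1:]" unfolding N_def by (rule prod.lessThan_Suc)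
    have nz: "N j \<noteq> 0" "[:- x j, 1:] \<noteq> 0" using Suc by auto
    have "degree (N (Suc j)) = Suc j" unfolding N degree_mult_eq[OF nz] using Suc by simp
    moreover have "lead_coeff (N (Suc j)) = 1"
    proof -
      have "lead_coeff (N j) = 1" "lead_coeff [:- x j, 1:] = 1" using Suc by auto
      thus ?thesis unfolding N lead_coeff_mult by (simp only: mult_1)
    qed
    ultimately show ?case by blast
  qed (simp add: N_def)
  have monic: "coeff (N j) j = 1" "degree (N j) = j" for j by (metis monic')+
  let ?V = "mat n n (\<lambda>(i, j). x i ^ j)"
  let ?U = "mat n n (\<lambda>(k, j). coeff (N j) k)"
  have V: "?V \<in> carrier_mat n n" and U: "?U \<in> carrier_mat n n" by auto
  have VU: "(?V * ?U) $$ (i, j) = (\<Prod>l<j. (x i - x l))" if ij: "i < n" "j < n" for i j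
  proof -
    have "(?V * ?U) $$ (i, j) = (\<Sum>k<n. coeff (N j) k * x i ^ k)"
      using ij by (simp add: scalar_prod_def atLeast0LessThan mult.commute)
    also have "\<dots> = (\<Sum>k\<le>degree (N j). coeff (N j) k * x i ^ k)"
      using ij monic(2)[of j] by (intro sum.mono_neutral_right) (auto simp: coeff_eq_0)
    also have "\<dots> = poly (N j) (x i)" by (rule poly_altdef[symmetric])
    also have "\<dots> = (\<Prod>l<j. (x i - x l))" by (simp add: N_def poly_prod)
    finally show ?thesis .
  qed
  have "Determinant.det ?U = prod_list (diag_mat ?U)"
    by (rule det_upper_triangular[OF _ U]) (auto simp: upper_triangular_def coeff_eq_0 monic)
  also have "\<dots> = 1"
    using monic by (auto simp: diag_mat_def prod.list_conv_set_nth intro!: prod.neutral)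
  finally have "Determinant.det ?V = Determinant.det (?V * ?U)" using det_mult[OF V U] by simp
  also have "\<dots> = prod_list (diag_mat (?V * ?U))"
  proof (rule det_lower_triangular)
    fix i j assume ij: "i < j" "j < n"
    show "(?V * ?U) $$ (i, j) = 0" using ij by (subst VU) auto
  qed (use V U in auto)
  also have "\<dots> = (\<Prod>k<n. (?V * ?U) $$ (k, k))"
    by (simp add: diag_mat_def prod.list_conv_set_nth atLeast0LessThan)
  also have "\<dots> = (\<Prod>k<n. \<Prod>j<k. (x k - x j))" by (intro prod.cong refl VU) auto
  finally show ?thesis .
qed

text \<open>
  The algebraic half of Andreief's integration formula. For fixed \<open>p\<close> the inner sum is the determinant
  of the Hankel matrix with rows permuted by \<open>p\<close>, and the two signs of \<open>p\<close> cancel, so all \<open>n!\<close> terms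
  of the outer sum agree.
\<close>

lemma sum_permutations_det_square:
  fixes m :: "nat \<Rightarrow> 'a :: comm_ring_1"
  shows "(\<Sum>p | p permutes {0..<n}. \<Sum>q | q permutes {0..<n}. signof p * signof q * (\<Prod>i=0..<n. m (p i + q i)))
      = of_nat (fact n) * Determinant.det (mat n n (\<lambda>(i, j). m (i + j)))"
proof -
  let ?A = "mat n n (\<lambda>(i, j). m (i + j))"
  have inner: "(\<Sum>q | q permutes {0..<n}. signof p * signof q * (\<Prod>i=0..<n. m (p i + q i))) = Determinant.det ?A"
    if p: "p permutes {0..<n}" for p
  proof -
    have pi: "p i < n" if "i < n" for i using permutes_in_image[OF p] that by simp
    have "(\<Sum>q | q permutes {0..<n}. signof p * signof q * (\<Prod>i=0..<n. m (p i + q i)))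
       = signof p * (\<Sum>q | q permutes {0..<n}. signof q * (\<Prod>i=0..<n. m (p i + q i)))"
      by (simp add: sum_distrib_left mult.assoc)
    also have "(\<Sum>q | q permutes {0..<n}. signof q * (\<Prod>i=0..<n. m (p i + q i))) = Determinant.det (mat n n (\<lambda>(i, j). ?A $$ (p i, j)))"
    proof (subst det_def'[of _ n], simp, intro sum.cong refl)
      fix q assume "q \<in> {q. q permutes {0..<n}}"
      hence "q i < n" if "i < n" for i using permutes_in_image[of q "{0..<n}" i] that by simp
      thus "signof q * (\<Prod>i=0..<n. m (p i + q i)) = signof q * (\<Prod>i=0..<n. mat n n (\<lambda>(i, j). ?A $$ (p i, j)) $$ (i, q i))"
        using pi by (intro arg_cong2[where f = "(*)"] prod.cong refl) auto
    qed
    also have "\<dots> = signof p * Determinant.det ?A" by (rule det_permute_rows) (use p in auto)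
    finally show ?thesis by (simp add: mult.assoc[symmetric] sign_def)
  qed
  have "(\<Sum>p | p permutes {0..<n}. \<Sum>q | q permutes {0..<n}. signof p * signof q * (\<Prod>i=0..<n. m (p i + q i)))
     = (\<Sum>p | p permutes {0..<n}. Determinant.det ?A)" by (rule sum.cong[OF refl], rule inner) simp
  also have "\<dots> = of_nat (fact n) * Determinant.det ?A"
  proof -
    have "card {p. p permutes {0..<n}} = fact n" by (rule card_permutations) auto
    thus ?thesis by (simp only: sum_constant)
  qed
  finally show ?thesis .
qed

section \<open>Absolute moments of the Gaussian weight\<close>

text \<open>
  The closed form of \<open>\<integral>x. |x|\<^sup>z exp (- x\<^sup>2/2)\<close> over the real line.
\<close>

definition gauss_mellin :: "complex \<Rightarrow> complex" where
  "gauss_mellin z = 2 powr ((z + 1) / 2) * Gamma ((z + 1) / 2)"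

text \<open>
  Integration by parts against the Gaussian weight, here a consequence of the functional equation of
  the Gamma function. It drives the evaluation of the Hankel determinant.
\<close>

lemma gauss_mellin_recurrence: "Re z \<ge> 0 \<Longrightarrow> gauss_mellin (z + 2) = (z + 1) * gauss_mellin z"
proof -
  assume z: "Re z \<ge> 0"
  have "(z + 1) / 2 \<notin> \<int>\<^sub>\<le>\<^sub>0" using z
    by (auto elim!: nonpos_Ints_cases' simp: complex_eq_iff)
  hence "Gamma ((z + 1) / 2 + 1) = (z + 1) / 2 * Gamma ((z + 1) / 2)" by (rule Gamma_plus1)
  moreover have "(z + 2 + 1) / 2 = (z + 1) / 2 + 1" by (simp add: field_simps)
  hence "gauss_mellin (z + 2) = 2 powr ((z + 1) / 2 + 1) * Gamma ((z + 1) / 2 + 1)" by (simp only: gauss_mellin_def)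
  moreover have "2 powr ((z + 1) / 2 + 1) = 2 powr ((z + 1) / 2) * (2 :: complex)"
    by (subst powr_add) simp
  ultimately show ?thesis by (simp only: gauss_mellin_def) simp
qed

text \<open>
  The substitution \<open>t = x\<^sup>2/2\<close> in Euler's integral for \<open>\<Gamma>((z + 1)/2)\<close>.
\<close>

lemma gaussian_abs_powr_has_integral:
  assumes z: "Re z \<ge> 0"
  shows "((\<lambda>x. of_real x powr z * of_real (exp (- x\<^sup>2 / 2))) has_integral (gauss_mellin z / 2)) {0<..}"
    and "(\<lambda>x. of_real x powr z * of_real (exp (- x\<^sup>2 / 2))) absolutely_integrable_on {0<..}"
proof -
  let ?f = "\<lambda>t. complex_of_real t powr ((z + 1) / 2 - 1) / of_real (exp t)"
  let ?g = "\<lambda>x::real. x\<^sup>2 / 2"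
  have Re: "Re ((z + 1) / 2) > 0" using z by simp
  have bij: "?g ` {0<..} = {0<..}"
  proof safe
    fix t :: real assume "t > 0"
    thus "t \<in> ?g ` {0<..}" by (intro image_eqI[of _ _ "sqrt (2 * t)"]) auto
  qed auto
  have inj: "inj_on ?g {0<..}"
    by (auto simp: inj_on_def power2_eq_iff)
  have der: "(?g has_field_derivative x) (at x within {0<..})" for x
    by (auto intro!: derivative_eq_intros)
  have L: "?f absolutely_integrable_on ?g ` {0<..} \<and> integral (?g ` {0<..}) ?f = Gamma ((z + 1) / 2)"
    unfolding bij using absolutely_integrable_Gamma_integral'[OF Re] Gamma_integral_complex'[OF Re]
    by (auto simp: integral_unique)
  have R: "(\<lambda>x. \<bar>x\<bar> *\<^sub>R ?f (?g x)) absolutely_integrable_on {0<..} \<and>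
      integral {0<..} (\<lambda>x. \<bar>x\<bar> *\<^sub>R ?f (?g x)) = Gamma ((z + 1) / 2)"
    using has_absolute_integral_change_of_variables_real[of "{0<..}" ?g "\<lambda>x. x" ?f "Gamma ((z + 1) / 2)"] L der inj
    by auto
  have eq: "of_real x powr z * of_real (exp (- x\<^sup>2 / 2)) = (2 powr ((z - 1) / 2)) * (\<bar>x\<bar> *\<^sub>R ?f (?g x))" if "x \<in> {0<..}" for x :: real
  proof -
    have x: "x > 0" using that by simp
    have "complex_of_real (?g x) powr ((z + 1) / 2 - 1) = exp ((z - 1) / 2 * of_real (ln (x\<^sup>2 / 2)))"
    proof -
      have "Ln (complex_of_real (?g x)) = of_real (ln (?g x))" using x by (intro Ln_of_real) auto
      moreover have "complex_of_real (?g x) \<noteq> 0" using x by simp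
      moreover have "(z + 1) / 2 - 1 = (z - 1) / 2" by (simp add: field_simps)
      ultimately show ?thesis by (simp only: powr_def if_False)
    qed
    also have "ln (x\<^sup>2 / 2) = 2 * ln x - ln 2" using x by (simp add: ln_div ln_realpow)
    also have "exp ((z - 1) / 2 * of_real (2 * ln x - ln 2)) = exp ((z - 1) * of_real (ln x)) * exp (- ((z - 1) / 2 * of_real (ln 2)))"
      by (simp add: exp_add[symmetric] field_simps)
    finally have 1: "complex_of_real (?g x) powr ((z + 1) / 2 - 1) = exp ((z - 1) * of_real (ln x)) * exp (- ((z - 1) / 2 * of_real (ln 2)))" .
    have 2: "2 powr ((z - 1) / 2) = exp ((z - 1) / 2 * of_real (ln 2))" 
      using Ln_of_real[of 2] by (simp add: powr_def)
    have 3: "of_real x powr z = exp ((z - 1) * of_real (ln x)) * of_real x"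
    proof -
      have "of_real x powr z = exp (z * of_real (ln x))" using x by (simp add: powr_def Ln_of_real)
      also have "\<dots> = exp ((z - 1) * of_real (ln x)) * exp (of_real (ln x))" by (simp add: exp_add[symmetric] algebra_simps)
      also have "exp (of_real (ln x)) = complex_of_real x" using x by (simp add: exp_of_real)
      finally show ?thesis .
    qed
    have 4: "complex_of_real (exp (- x\<^sup>2 / 2)) = 1 / of_real (exp (?g x))" by (simp add: exp_minus field_simps)
    show ?thesis unfolding 1 2 3 4 using x by (simp add: scaleR_conv_of_real exp_minus field_simps)
  qed
  have c: "2 powr ((z - 1) / 2) * Gamma ((z + 1) / 2) = gauss_mellin z / 2"
  proof -
    have "(z + 1) / 2 = (z - 1) / 2 + 1" by (simp add: field_simps)
    hence "2 powr ((z + 1) / 2) = 2 powr ((z - 1) / 2 + 1)" by (rule arg_cong)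
    also have "\<dots> = 2 powr ((z - 1) / 2) * (2::complex)" by (subst powr_add) simp
    finally have "2 powr ((z + 1) / 2) = 2 powr ((z - 1) / 2) * (2::complex)" .
    thus ?thesis by (simp add: gauss_mellin_def)
  qed
  have "((\<lambda>x. \<bar>x\<bar> *\<^sub>R ?f (?g x)) has_integral Gamma ((z + 1) / 2)) {0<..}"
    using R integrable_integral[OF set_lebesgue_integral_eq_integral(1), of "{0<..}" "\<lambda>x. \<bar>x\<bar> *\<^sub>R ?f (?g x)"] by simp
  hence "((\<lambda>x. (2 powr ((z - 1) / 2)) * (\<bar>x\<bar> *\<^sub>R ?f (?g x))) has_integral gauss_mellin z / 2) {0<..}"
    unfolding c[symmetric] by (rule has_integral_mult_right)
  thus "((\<lambda>x. of_real x powr z * of_real (exp (- x\<^sup>2 / 2))) has_integral (gauss_mellin z / 2)) {0<..}"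
    by (rule has_integral_eq[rotated]) (use eq in auto)
  have "(\<lambda>x. (2 powr ((z - 1) / 2)) * (\<bar>x\<bar> *\<^sub>R ?f (?g x))) absolutely_integrable_on {0<..}"
    using R by (intro set_integrable_mult_right) auto
  thus "(\<lambda>x. of_real x powr z * of_real (exp (- x\<^sup>2 / 2))) absolutely_integrable_on {0<..}"
    by (rule absolutely_integrable_spike[where S="{}"]) (use eq in auto)
qed

text \<open>
  The integrand of the \<open>k\<close>-th moment of the weight \<open>|x|\<^sup>z exp (- x\<^sup>2/2)\<close>. The power is written with
  \<open>exp\<close> and \<open>ln\<close> so that products over several variables combine without a side condition; the value at
  \<open>x = 0\<close> is irrelevant for integrals.
\<close>

definition gauss_monomial :: "complex \<Rightarrow> nat \<Rightarrow> real \<Rightarrow> complex" where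
  "gauss_monomial z k x = of_real x ^ k * exp (z * of_real (ln \<bar>x\<bar>)) * of_real (exp (- x\<^sup>2 / 2))"

lemma gauss_monomial_measurable [measurable]: "gauss_monomial z k \<in> borel_measurable borel"
  unfolding gauss_monomial_def by measurable

text \<open>
  Odd moments cancel by symmetry, and even ones are absolute moments of a shifted exponent.
\<close>

lemma gauss_monomial_integral:
  assumes z: "Re z \<ge> 0"
  shows "integrable lborel (gauss_monomial z k)"
    and "(\<integral>x. gauss_monomial z k x \<partial>lborel) = (if even k then gauss_mellin (z + of_nat k) else 0)"
proof -
  have zk: "Re (z + of_nat k) \<ge> 0" using z by simp
  let ?f = "\<lambda>x. indicator {0<..} x *\<^sub>R gauss_monomial z k x"
  have gw_eq: "gauss_monomial z k x = of_real x powr (z + of_nat k) * of_real (exp (- x\<^sup>2 / 2))" if "x > 0" for x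
  proof -
    have "exp (of_nat k * complex_of_real (ln x)) = of_real x ^ k"
      using that by (simp add: exp_of_nat_mult exp_of_real)
    thus ?thesis using that by (simp add: gauss_monomial_def powr_def Ln_of_real exp_add distrib_right)
  qed
  have "gauss_monomial z k absolutely_integrable_on {0<..}"
    by (rule absolutely_integrable_spike[where S="{}", OF gaussian_abs_powr_has_integral(2)[OF zk]])
       (use gw_eq in auto)
  hence intf: "integrable lborel ?f"
    by (simp add: set_integrable_def integrable_completion)
  have "(gauss_monomial z k has_integral gauss_mellin (z + of_nat k) / 2) {0<..}"
    by (rule has_integral_eq[rotated, OF gaussian_abs_powr_has_integral(1)[OF zk]]) (use gw_eq in auto)
  moreover have "(gauss_monomial z k has_integral (\<integral>x. ?f x \<partial>lborel)) {0<..}"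
    using has_integral_set_lebesgue[of "{0<..}" "gauss_monomial z k"] intf
    by (simp add: set_integrable_def integrable_completion set_lebesgue_integral_def integral_completion)
  ultimately have If: "(\<integral>x. ?f x \<partial>lborel) = gauss_mellin (z + of_nat k) / 2"
    using has_integral_unique by blast
  have neg: "gauss_monomial z k (- x) = (-1) ^ k * gauss_monomial z k x" for x by (simp add: gauss_monomial_def power_minus[of "of_real x"])
  have intg: "integrable lborel (\<lambda>x. ?f (- x))"
    using lborel_integrable_real_affine[OF intf, of "-1" 0] by simp
  have Ig: "(\<integral>x. ?f (- x) \<partial>lborel) = gauss_mellin (z + of_nat k) / 2"
    using lborel_integral_real_affine[of "-1" ?f 0] If by simp
  have ae: "AE x in lborel. gauss_monomial z k x = ?f x + (-1) ^ k * ?f (- x)"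
  proof (intro AE_I[of _ _ "{0}"] subsetI)
    fix x assume "x \<in> {x \<in> space lborel. \<not> gauss_monomial z k x = ?f x + (-1) ^ k * ?f (- x)}"
    moreover have "gauss_monomial z k x = ?f x + (-1) ^ k * ?f (- x)" if "x \<noteq> 0"
      using that neg[of x] by (cases "x > 0") (auto simp: power_mult_distrib[symmetric] mult.assoc[symmetric])
    ultimately show "x \<in> {0}" by auto
  qed auto
  have int: "integrable lborel (\<lambda>x. ?f x + (-1) ^ k * ?f (- x))"
    using intf intg by (intro Bochner_Integration.integrable_add integrable_mult_right)
  show "integrable lborel (gauss_monomial z k)"
    using int integrable_cong_AE[OF _ _ ae] by auto
  have "(\<integral>x. gauss_monomial z k x \<partial>lborel) = (\<integral>x. ?f x + (-1) ^ k * ?f (- x) \<partial>lborel)"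
    by (rule integral_cong_AE[OF _ _ ae]) auto
  also have "\<dots> = (\<integral>x. ?f x \<partial>lborel) + (-1) ^ k * (\<integral>x. ?f (- x) \<partial>lborel)"
    using Bochner_Integration.integral_add[OF intf integrable_mult_right[OF intg, of "(-1) ^ k"]]
    by (simp only: integral_mult_right_zero)
  also have "\<dots> = (if even k then gauss_mellin (z + of_nat k) else 0)"
    unfolding If Ig by simp
  finally show "(\<integral>x. gauss_monomial z k x \<partial>lborel) = (if even k then gauss_mellin (z + of_nat k) else 0)" .
qed

section \<open>The Hankel determinant of the Gaussian moments\<close>

definition gauss_moment :: "complex \<Rightarrow> nat \<Rightarrow> complex" where
  "gauss_moment z k = (if even k then gauss_mellin (z + of_nat k) else 0)"

definition hankel :: "nat \<Rightarrow> complex \<Rightarrow> complex mat" where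
  "hankel n z = mat n n (\<lambda>(i, j). gauss_moment z (i + j))"

lemma det_mat_scale_cols:
  fixes f :: "nat \<times> nat \<Rightarrow> 'a :: comm_ring_1"
  shows "Determinant.det (mat n n (\<lambda>(i, j). c j * f (i, j))) = (\<Prod>j<n. c j) * Determinant.det (mat n n f)"
proof -
  have "signof p * (\<Prod>i=0..<n. mat n n (\<lambda>(i, j). c j * f (i, j)) $$ (i, p i))
      = (\<Prod>j<n. c j) * (signof p * (\<Prod>i=0..<n. mat n n f $$ (i, p i)))" if p: "p permutes {0..<n}" for p
  proof -
    have pi: "p i < n" if "i < n" for i using permutes_in_image[OF p] that by simp
    have "(\<Prod>i=0..<n. mat n n (\<lambda>(i, j). c j * f (i, j)) $$ (i, p i)) = (\<Prod>i=0..<n. c (p i)) * (\<Prod>i=0..<n. mat n n f $$ (i, p i))"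
      unfolding prod.distrib[symmetric] by (intro prod.cong refl) (use pi in auto)
    also have "(\<Prod>i=0..<n. c (p i)) = (\<Prod>j=0..<n. c j)"
      using prod.permute[OF p, of c] by (simp add: o_def)
    finally show ?thesis by (simp add: atLeast0LessThan mult_ac)
  qed
  thus ?thesis by (simp add: det_def'[of _ n] sum_distrib_left)
qed

text \<open>
  Subtracting from row \<open>i\<close> a multiple of row \<open>i - 2\<close> turns, by the recurrence for the moments, each
  entry into \<open>2 \<lfloor>j/2\<rfloor>\<close> times the moment of order \<open>i + j - 2\<close>. The multiplier depends on the parity of
  \<open>i\<close>, which agrees with the parity of \<open>j\<close> at nonzero entries. The first two columns then vanish
  below the top block, and the remaining block is a column-scaled Hankel matrix for \<open>z + 2\<close>.
\<close>

lemma det_hankel_step: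
  assumes z: "Re z \<ge> 0"
  shows "Determinant.det (hankel (n + 2) z) =
     (\<Prod>j<n. of_nat (2 * ((j + 2) div 2))) * (gauss_mellin z * gauss_mellin (z + 2)) * Determinant.det (hankel n (z + 2))"
proof -
  \<comment> \<open>the multiplier that leaves an even integer in the reduced row, for either parity\<close>
  define \<alpha> where "\<alpha> i = z + (if even i then of_nat i - 1 else of_nat i)" for i :: nat
  define T where "T = mat (n + 2) (n + 2) (\<lambda>(i, k). if k = i then 1 else if k + 2 = i then - \<alpha> i else 0)"
  have T: "T \<in> carrier_mat (n + 2) (n + 2)" by (simp add: T_def)
  have Hc: "hankel (n + 2) z \<in> carrier_mat (n + 2) (n + 2)" by (simp add: hankel_def)
  have detT: "Determinant.det T = 1"
  proof -
    have "Determinant.det T = prod_list (diag_mat T)"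
      by (rule det_lower_triangular[OF _ T]) (auto simp: T_def)
    thus ?thesis by (auto simp: diag_mat_def T_def prod.list_conv_set_nth intro!: prod.neutral simp del: upt_Suc)
  qed
  have m_rec: "gauss_moment z (k + 2) = (z + of_nat k + 1) * gauss_moment z k" for k
    using gauss_mellin_recurrence[of "z + of_nat k"] z by (simp add: gauss_moment_def add_ac)
  have TH: "(T * hankel (n + 2) z) $$ (i, j) =
      (if i < 2 then gauss_moment z (i + j) else of_nat (2 * (j div 2)) * gauss_moment z (i + j - 2))"
    if ij: "i < n + 2" "j < n + 2" for i j
  proof -
    have "(T * hankel (n + 2) z) $$ (i, j) = (\<Sum>k<n+2. (if k = i then 1 else if k + 2 = i then - \<alpha> i else 0) * gauss_moment z (k + j))"
      using ij by (simp add: T_def hankel_def scalar_prod_def atLeast0LessThan del: sum.lessThan_Suc sum.op_ivl_Suc)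
    also have "\<dots> = (\<Sum>k<n+2. (if k = i then gauss_moment z (i + j) else 0) + (if k + 2 = i then - \<alpha> i * gauss_moment z (k + j) else 0))"
      by (intro sum.cong) auto
    also have "\<dots> = gauss_moment z (i + j) + (\<Sum>k<n+2. (if k + 2 = i then - \<alpha> i * gauss_moment z (k + j) else 0))"
      using ij by (simp add: sum.distrib del: sum.lessThan_Suc)
    also have "(\<Sum>k<n+2. (if k + 2 = i then - \<alpha> i * gauss_moment z (k + j) else 0)) = (if i < 2 then 0 else - \<alpha> i * gauss_moment z (i + j - 2))"
    proof (cases "i < 2")
      case False
      hence "(\<Sum>k<n+2. (if k + 2 = i then - \<alpha> i * gauss_moment z (k + j) else 0)) = (\<Sum>k<n+2. (if k = i - 2 then - \<alpha> i * gauss_moment z (i - 2 + j) else 0))"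
        by (intro sum.cong) auto
      also have "\<dots> = - \<alpha> i * gauss_moment z (i - 2 + j)"
        using ij by (simp del: sum.lessThan_Suc)
      finally show ?thesis using False by simp
    qed (auto intro!: sum.neutral)
    finally have eq: "(T * hankel (n + 2) z) $$ (i, j) = gauss_moment z (i + j) + (if i < 2 then 0 else - \<alpha> i * gauss_moment z (i + j - 2))" .
    show ?thesis
    proof (cases "i < 2")
      case False
      define k where "k = i + j - 2"
      have k: "i + j = k + 2" using False by (simp add: k_def)
      have "gauss_moment z (i + j) - \<alpha> i * gauss_moment z (i + j - 2) = (z + of_nat k + 1 - \<alpha> i) * gauss_moment z k"
        unfolding k m_rec by (simp add: algebra_simps)
      also have "\<dots> = of_nat (2 * (j div 2)) * gauss_moment z k"
      proof (cases "even k")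
        case True
        have "of_nat k = of_nat i + of_nat j - (2 :: complex)" using k by (metis add_diff_cancel_right' of_nat_add of_nat_numeral)
        moreover have "even i = even j" using True k by (metis even_add even_numeral)
        ultimately have "z + of_nat k + 1 - \<alpha> i = of_nat (2 * (j div 2))"
          by (auto simp: \<alpha>_def elim!: evenE oddE)
        thus ?thesis by simp
      qed (simp add: gauss_moment_def)
      finally show ?thesis using False unfolding eq k_def by simp
    qed (use eq in simp)
  qed
  let ?A1 = "mat 2 2 (\<lambda>(i, j). gauss_moment z (i + j))"
  let ?A2 = "mat 2 n (\<lambda>(i, j). gauss_moment z (i + (j + 2)))"
  let ?A4 = "mat n n (\<lambda>(i, j). of_nat (2 * ((j + 2) div 2)) * gauss_moment (z + 2) (i + j))"
  have block: "T * hankel (n + 2) z = four_block_mat ?A1 ?A2 (0\<^sub>m n 2) ?A4"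
  proof (rule eq_matI)
    fix i j assume ij: "i < dim_row (four_block_mat ?A1 ?A2 (0\<^sub>m n 2) ?A4)" "j < dim_col (four_block_mat ?A1 ?A2 (0\<^sub>m n 2) ?A4)"
    hence ij': "i < n + 2" "j < n + 2" by auto
    consider "i < 2" "j < 2" | "i < 2" "j \<ge> 2" | "i \<ge> 2" "j < 2" | "i \<ge> 2" "j \<ge> 2" by linarith
    thus "(T * hankel (n + 2) z) $$ (i, j) = four_block_mat ?A1 ?A2 (0\<^sub>m n 2) ?A4 $$ (i, j)"
    proof cases
      case 1
      thus ?thesis using ij' unfolding TH[OF ij'] by (simp add: index_mat_four_block)
    next
      case 2
      then obtain j' where "j = j' + 2" by (metis add.commute le_Suc_ex)
      thus ?thesis using ij' 2 unfolding TH[OF ij'] by (simp add: index_mat_four_block)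
    next
      case 3
      then obtain i' where "i = i' + 2" by (metis add.commute le_Suc_ex)
      thus ?thesis using ij' 3 unfolding TH[OF ij'] by (simp add: index_mat_four_block)
    next
      case 4
      then obtain i' j' where e: "i = i' + 2" "j = j' + 2" by (metis add.commute le_Suc_ex)
      have t: "(T * hankel (n + 2) z) $$ (i, j) = of_nat (2 * (j div 2)) * gauss_moment z (i + j - 2)"
        using 4 by (subst TH[OF ij']) simp
      have m: "gauss_moment z (i + j - 2) = gauss_moment (z + 2) (i' + j')" unfolding e by (simp add: gauss_moment_def add_ac)
      have b: "four_block_mat ?A1 ?A2 (0\<^sub>m n 2) ?A4 $$ (i, j) = of_nat (2 * ((j' + 2) div 2)) * gauss_moment (z + 2) (i' + j')"
        using ij' unfolding e by (simp add: index_mat_four_block)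
      show ?thesis unfolding t m b by (simp only: e(2))
    qed
  qed (use T Hc in auto)
  have "Determinant.det (hankel (n + 2) z) = Determinant.det (T * hankel (n + 2) z)"
    using det_mult[OF T Hc] detT by simp
  also have "\<dots> = Determinant.det ?A1 * Determinant.det ?A4"
    unfolding block by (rule det_four_block_mat_lower_left_zero[of _ 2 _ n]) auto
  also have "Determinant.det ?A1 = gauss_mellin z * gauss_mellin (z + 2)"
  proof -
    have "Determinant.det ?A1 = prod_list (diag_mat ?A1)"
      by (rule det_upper_triangular[of _ 2]) (auto simp: upper_triangular_def gauss_moment_def dest!: less_2_cases)
    also have "\<dots> = gauss_mellin z * gauss_mellin (z + 2)"
      by (simp add: diag_mat_def gauss_moment_def numeral_2_eq_2)
    finally show ?thesis .
  qed
  also have "Determinant.det ?A4 = (\<Prod>j<n. of_nat (2 * ((j + 2) div 2))) * Determinant.det (hankel n (z + 2))"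
    unfolding hankel_def
    using det_mat_scale_cols[of n "\<lambda>j. of_nat (2 * ((j + 2) div 2))" "\<lambda>(i, j). gauss_moment (z + 2) (i + j)"] by simp
  finally show ?thesis by (simp only: mult_ac)
qed

text \<open>
  The constant does not depend on \<open>z\<close>; it is determined later by total mass 1 at \<open>z = 0\<close>.
\<close>

lemma det_hankel:
  "\<exists>c. \<forall>z. Re z \<ge> 0 \<longrightarrow> Determinant.det (hankel n z) = c * (\<Prod>k=1..n. gauss_mellin (z + 2 * of_nat (k div 2)))"
proof (induction n rule: induct_nat_012)
  case 0
  show ?case by (intro exI[of _ 1]) (simp add: hankel_def)
next
  case 1
  have "Determinant.det (hankel 1 z) = gauss_mellin z" for z
    by (subst det_single) (auto simp: hankel_def gauss_moment_def)
  thus ?case by (intro exI[of _ 1]) simp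
next
  case (ge2 n)
  then obtain c where c: "\<And>z. Re z \<ge> 0 \<Longrightarrow> Determinant.det (hankel n z) = c * (\<Prod>k=1..n. gauss_mellin (z + 2 * of_nat (k div 2)))" by blast
  have prod: "(\<Prod>k=1..n+2. gauss_mellin (z + 2 * of_nat (k div 2))) = (gauss_mellin z * gauss_mellin (z + 2)) * (\<Prod>k=1..n. gauss_mellin (z + 2 + 2 * of_nat (k div 2)))" for z
  proof -
    have "{1..n+2} = {1, 2} \<union> (\<lambda>k. k + 2) ` {1..n}"
    proof (intro equalityI subsetI)
      fix k assume "k \<in> {1..n+2}"
      thus "k \<in> {1, 2} \<union> (\<lambda>k. k + 2) ` {1..n}"
        by (cases "k \<le> 2") (auto intro!: image_eqI[of _ _ "k - 2"])
    qed auto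
    hence "(\<Prod>k=1..n+2. gauss_mellin (z + 2 * of_nat (k div 2))) = (\<Prod>k\<in>{1,2}. gauss_mellin (z + 2 * of_nat (k div 2))) * (\<Prod>k\<in>(\<lambda>k. k + 2) ` {1..n}. gauss_mellin (z + 2 * of_nat (k div 2)))"
      by (simp only:) (rule prod.union_disjoint, auto)
    also have "(\<Prod>k\<in>(\<lambda>k. k + 2) ` {1..n}. gauss_mellin (z + 2 * of_nat (k div 2))) = (\<Prod>k=1..n. gauss_mellin (z + 2 + 2 * of_nat (k div 2)))"
      by (subst prod.reindex) (auto simp: inj_on_def add_ac ring_distribs intro!: prod.cong)
    finally show ?thesis by simp
  qed
  show ?case
  proof (intro exI allI impI)
    fix z :: complex assume z: "Re z \<ge> 0"
    have "Determinant.det (hankel (n + 2) z) = (\<Prod>j<n. of_nat (2 * ((j + 2) div 2))) * (gauss_mellin z * gauss_mellin (z + 2)) * (c * (\<Prod>k=1..n. gauss_mellin (z + 2 + 2 * of_nat (k div 2))))"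
      using det_hankel_step[OF z, of n] c[of "z + 2"] z by simp
    also have "\<dots> = ((\<Prod>j<n. of_nat (2 * ((j + 2) div 2))) * c) * (\<Prod>k=1..n+2. gauss_mellin (z + 2 * of_nat (k div 2)))"
      unfolding prod by (simp only: mult_ac)
    finally show "Determinant.det (hankel (Suc (Suc n)) z) = ((\<Prod>j<n. of_nat (2 * ((j + 2) div 2))) * c) * (\<Prod>k=1..Suc (Suc n). gauss_mellin (z + 2 * of_nat (k div 2)))"
      by simp
  qed
qed

section \<open>The Mellin transform of the determinant\<close>

text \<open>
  The moment generating function of the centred log-determinant: apart from the centring, the product
  of the Mellin transforms of chi variables with \<open>2 \<lfloor>k/2\<rfloor> + 1\<close> degrees of freedom.
\<close>

definition gue_mgf :: "nat \<Rightarrow> complex \<Rightarrow> complex" where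
  "gue_mgf n z = exp (- z * of_real (gue_mu n)) *
     (\<Prod>k=1..n. gauss_mellin (z + 2 * of_nat (k div 2)) / gauss_mellin (2 * of_nat (k div 2)))"

text \<open>
  The entries on and above the diagonal and their conjugates are recovered from the real coordinates,
  and the determinant is a polynomial in the entries.
\<close>

lemma GUE_det_measurable:
  assumes G: "GUE M n \<sigma> W"
  shows "(\<lambda>\<omega>. Determinant.det (W \<omega>)) \<in> borel_measurable M"
proof -
  have W: "W \<omega> \<in> carrier_mat n n" "hermitian (W \<omega>)" if "\<omega> \<in> space M" for \<omega>
    using G that by (auto simp: GUE_def)
  have hc: "(\<lambda>\<omega>. herm_coord (i, j) (W \<omega>)) \<in> borel_measurable M" if "i < n" "j < n" for i j
    using G that distributed_measurable[of M lborel "\<lambda>\<omega>. herm_coord (i, j) (W \<omega>)"] unfolding GUE_def by fastforce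
  have entry: "(\<lambda>\<omega>. W \<omega> $$ (i, j)) \<in> borel_measurable M" if ij: "i < n" "j < n" for i j
  proof -
    define f where "f \<omega> = of_real (herm_coord (min i j, max i j) (W \<omega>)) + \<i> * of_real
        (if i = j then 0 else if i < j then - herm_coord (j, i) (W \<omega>) else herm_coord (i, j) (W \<omega>))" for \<omega>
    have "f \<in> borel_measurable M"
      unfolding f_def using hc ij by (cases "i = j"; cases "i < j") (auto intro!: borel_measurable_add borel_measurable_times borel_measurable_uminus measurable_compose[OF _ borel_measurable_of_real] simp: min_def max_def)
    moreover have "W \<omega> $$ (i, j) = f \<omega>" if "\<omega> \<in> space M" for \<omega>
    proof -
      have h: "W \<omega> $$ (i, j) = cnj (W \<omega> $$ (j, i))" by (rule hermitian_entry[OF W[OF that] ij])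
      hence "Re (W \<omega> $$ (i, j)) = Re (W \<omega> $$ (j, i))" "Im (W \<omega> $$ (i, j)) = - Im (W \<omega> $$ (j, i))"
        by (metis cnj.simps)+
      thus ?thesis by (auto simp: f_def herm_coord_def complex_eq_iff min_def max_def)
    qed
    ultimately show ?thesis by (subst measurable_cong[of M _ f]) auto
  qed
  have "(\<lambda>\<omega>. \<Sum>p | p permutes {0..<n}. signof p * (\<Prod>i=0..<n. W \<omega> $$ (i, p i))) \<in> borel_measurable M"
  proof (intro borel_measurable_sum borel_measurable_times borel_measurable_prod entry borel_measurable_const)
    fix p i assume "p \<in> {p. p permutes {0..<n}}" "i \<in> {0..<n}"
    thus "i < n" "p i < n" using permutes_in_image[of p "{0..<n}" i] by auto
  qed
  also have "?this \<longleftrightarrow> ?thesis"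
    by (intro measurable_cong) (use det_def'[OF W(1)] in auto)
  finally show ?thesis .
qed

lemma gue_weight_measurable: "gue_weight n \<in> borel_measurable (\<Pi>\<^sub>M i\<in>{..<n}. lborel)"
proof -
  have comp: "(\<lambda>x. x k) \<in> borel_measurable (\<Pi>\<^sub>M i\<in>{..<n}. lborel)" if "k < n" for k
    using measurable_component_singleton[of k "{..<n}" "\<lambda>_. lborel"] that by simp
  show ?thesis unfolding gue_weight_def[abs_def]
    by (intro borel_measurable_times borel_measurable_prod borel_measurable_power borel_measurable_abs
          borel_measurable_diff measurable_compose[OF _ borel_measurable_exp] borel_measurable_divide
          borel_measurable_uminus borel_measurable_const comp) auto
qed

text \<open>
  Each of the two Vandermonde factors is expanded as a sum over permutations, after which every term
  is a product of functions of one variable.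
\<close>

lemma gue_weight_expansion:
  "of_real (gue_weight n x) * exp (z * of_real (\<Sum>i<n. ln \<bar>x i\<bar>)) =
     (\<Sum>p | p permutes {0..<n}. \<Sum>q | q permutes {0..<n}. signof p * signof q * (\<Prod>i<n. gauss_monomial z (p i + q i) (x i)))"
proof -
  let ?V = "mat n n (\<lambda>(i, j). complex_of_real (x i) ^ j)"
  let ?w = "\<Prod>i<n. exp (z * of_real (ln \<bar>x i\<bar>)) * of_real (exp (- (x i)\<^sup>2 / 2))"
  have V: "Determinant.det ?V = (\<Sum>p | p permutes {0..<n}. signof p * (\<Prod>i<n. of_real (x i) ^ p i))"
  proof (subst det_def'[of _ n], simp, intro sum.cong refl)
    fix p assume "p \<in> {p. p permutes {0..<n}}"
    hence "p i < n" if "i < n" for i using permutes_in_image[of p "{0..<n}" i] that by simp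
    thus "signof p * (\<Prod>i=0..<n. ?V $$ (i, p i)) = signof p * (\<Prod>i<n. of_real (x i) ^ p i)"
      by (intro arg_cong2[where f = "(*)"] prod.cong refl) auto
  qed
  have sq: "of_real (\<Prod>k<n. \<Prod>j<k. \<bar>x k - x j\<bar>\<^sup>2) = Determinant.det ?V * Determinant.det ?V"
  proof -
    have v: "Determinant.det ?V = of_real (\<Prod>k<n. \<Prod>j<k. (x k - x j))"
      unfolding vandermonde_det by simp
    have "(\<Prod>k<n. \<Prod>j<k. \<bar>x k - x j\<bar>\<^sup>2) = (\<Prod>k<n. \<Prod>j<k. (x k - x j)\<^sup>2)"
      by (simp only: power2_abs)
    also have "\<dots> = (\<Prod>k<n. \<Prod>j<k. (x k - x j)) * (\<Prod>k<n. \<Prod>j<k. (x k - x j))"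
      by (simp only: power2_eq_square prod.distrib)
    finally show ?thesis unfolding v by (simp only: of_real_mult)
  qed
  have e: "exp (z * of_real (\<Sum>i<n. ln \<bar>x i\<bar>)) = (\<Prod>i<n. exp (z * of_real (ln \<bar>x i\<bar>)))"
    unfolding of_real_sum sum_distrib_left by (rule exp_sum) simp
  have w: "of_real (gue_weight n x) = Determinant.det ?V * Determinant.det ?V * (\<Prod>i<n. of_real (exp (- (x i)\<^sup>2 / 2)))"
    unfolding gue_weight_def of_real_mult sq unfolding of_real_prod ..
  have "of_real (gue_weight n x) * exp (z * of_real (\<Sum>i<n. ln \<bar>x i\<bar>)) =
     (Determinant.det ?V * Determinant.det ?V) * ?w"
    unfolding w e prod.distrib by (simp only: mult_ac)
  also have "\<dots> = (\<Sum>p | p permutes {0..<n}. \<Sum>q | q permutes {0..<n}.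
      (signof p * (\<Prod>i<n. of_real (x i) ^ p i)) * (signof q * (\<Prod>i<n. of_real (x i) ^ q i)) * ?w)"
    unfolding V sum_product unfolding sum_distrib_right ..
  also have "\<dots> = (\<Sum>p | p permutes {0..<n}. \<Sum>q | q permutes {0..<n}. signof p * signof q * (\<Prod>i<n. gauss_monomial z (p i + q i) (x i)))"
  proof (intro sum.cong refl)
    fix p q
    have "(\<Prod>i<n. gauss_monomial z (p i + q i) (x i)) = (\<Prod>i<n. of_real (x i) ^ p i) * (\<Prod>i<n. of_real (x i) ^ q i) * ?w"
      unfolding gauss_monomial_def prod.distrib[symmetric] by (intro prod.cong refl) (simp add: power_add)
    thus "(signof p * (\<Prod>i<n. of_real (x i) ^ p i)) * (signof q * (\<Prod>i<n. of_real (x i) ^ q i)) * ?w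
       = signof p * signof q * (\<Prod>i<n. gauss_monomial z (p i + q i) (x i))" by (simp only: mult_ac)
  qed
  finally show ?thesis .
qed

lemma gue_weight_mellin:
  fixes n :: nat
  assumes z: "Re z \<ge> 0"
  defines "f \<equiv> (\<lambda>x. of_real (gue_weight n x) * exp (z * of_real (\<Sum>i<n. ln \<bar>x i\<bar>)))"
  shows "integrable (\<Pi>\<^sub>M i\<in>{..<n}. lborel) f"
    and "(\<integral>x. f x \<partial>(\<Pi>\<^sub>M i\<in>{..<n}. lborel)) = of_nat (fact n) * Determinant.det (hankel n z)"
proof -
  interpret product_sigma_finite "\<lambda>_ :: nat. lborel :: real measure" ..
  have f: "f = (\<lambda>x. \<Sum>p | p permutes {0..<n}. \<Sum>q | q permutes {0..<n}. signof p * signof q * (\<Prod>i<n. gauss_monomial z (p i + q i) (x i)))"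
    unfolding f_def gue_weight_expansion ..
  have int: "integrable (\<Pi>\<^sub>M i\<in>{..<n}. lborel) (\<lambda>x. \<Prod>i<n. gauss_monomial z (k i) (x i))" for k
    by (rule product_integrable_prod) (use gauss_monomial_integral(1)[OF z] in auto)
  have I: "(\<integral>x. (\<Prod>i<n. gauss_monomial z (k i) (x i)) \<partial>(\<Pi>\<^sub>M i\<in>{..<n}. lborel)) = (\<Prod>i<n. gauss_moment z (k i))" for k
    by (subst product_integral_prod) (use gauss_monomial_integral[OF z] in \<open>auto simp: gauss_moment_def\<close>)
  show "integrable (\<Pi>\<^sub>M i\<in>{..<n}. lborel) f"
    unfolding f by (intro Bochner_Integration.integrable_sum integrable_mult_right int)
  have "(\<integral>x. f x \<partial>(\<Pi>\<^sub>M i\<in>{..<n}. lborel)) =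
     (\<Sum>p | p permutes {0..<n}. \<Sum>q | q permutes {0..<n}. signof p * signof q * (\<Prod>i<n. gauss_moment z (p i + q i)))"
    unfolding f by (simp only: Bochner_Integration.integral_sum Bochner_Integration.integrable_sum integrable_mult_right int integral_mult_right_zero I)
  also have "\<dots> = of_nat (fact n) * Determinant.det (hankel n z)"
    using sum_permutations_det_square[where n = n and m = "gauss_moment z"] unfolding hankel_def by (simp only: atLeast0LessThan)
  finally show "(\<integral>x. f x \<partial>(\<Pi>\<^sub>M i\<in>{..<n}. lborel)) = of_nat (fact n) * Determinant.det (hankel n z)" .
qed

text \<open>
  Needed because \<open>ln\<close> turns the product of the eigenvalues into a sum only off the coordinate
  hyperplanes.
\<close>

lemma AE_PiM_lborel_nonzero:
  fixes n :: nat
  shows "AE x in (\<Pi>\<^sub>M i\<in>{..<n}. lborel :: real measure). \<forall>i<n. x i \<noteq> 0"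
proof -
  interpret product_sigma_finite "\<lambda>_ :: nat. lborel :: real measure" ..
  have "AE x in (\<Pi>\<^sub>M i\<in>{..<n}. lborel :: real measure). x i \<noteq> 0" if i: "i < n" for i
  proof (rule AE_I)
    let ?N = "Pi\<^sub>E {..<n} (\<lambda>j. if j = i then {0} else (UNIV :: real set))"
    show "{x \<in> space (\<Pi>\<^sub>M i\<in>{..<n}. lborel). \<not> x i \<noteq> 0} \<subseteq> ?N"
      by (auto simp: space_PiM PiE_iff extensional_def)
    show "?N \<in> sets (\<Pi>\<^sub>M i\<in>{..<n}. lborel)" by (intro sets_PiM_I_finite) auto
    have "emeasure (\<Pi>\<^sub>M i\<in>{..<n}. lborel) ?N = (\<Prod>j<n. emeasure lborel (if j = i then {0} else (UNIV :: real set)))"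
      by (rule emeasure_PiM) auto
    also have "\<dots> = 0" using i by (intro prod_zero) auto
    finally show "emeasure (\<Pi>\<^sub>M i\<in>{..<n}. lborel) ?N = 0" .
  qed
  thus ?thesis by (auto simp: AE_all_countable)
qed

text \<open>
  The labelled eigenvalues live on the product of the probability space with the random permutation,
  where their law has a density; the product of their absolute values is invariant under relabelling,
  so the integrals over the product space are integrals over the original one.
\<close>

lemma normalized_GUE_mgf:
  fixes W :: "'a \<Rightarrow> complex mat"
  assumes G: "normalized_GUE M n W"
  defines "X \<equiv> (\<lambda>\<omega>. log_det_centered n (W \<omega>))"
  shows "prob_space M" and "X \<in> borel_measurable M"
    and "Re z \<ge> 0 \<Longrightarrow> integrable M (\<lambda>\<omega>. exp (z * of_real (X \<omega>)))"
    and "Re z \<ge> 0 \<Longrightarrow> (\<integral>\<omega>. exp (z * of_real (X \<omega>)) \<partial>M) = gue_mgf n z"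
proof -
  obtain \<sigma> c where GUE: "GUE M n \<sigma> W" and c: "c > 0"
    and dens: "eigenvalues_have_density M n W (\<lambda>x. c * gue_weight n x)"
    using G by (auto simp: normalized_GUE_def)
  show M: "prob_space M" using GUE by (simp add: GUE_def)
  interpret M: prob_space M by fact
  note [measurable] = GUE_det_measurable[OF GUE]
  show X[measurable]: "X \<in> borel_measurable M"
    unfolding X_def log_det_centered_def by measurable
  have W: "W \<omega> \<in> carrier_mat n n" "hermitian (W \<omega>)" if "\<omega> \<in> space M" for \<omega>
    using GUE that by (auto simp: GUE_def)
  define Q where "Q = measure_pmf (pmf_of_set {\<pi>. \<pi> permutes {..<n}})"
  define N where "N = M \<Otimes>\<^sub>M Q"
  define L where "L = (\<Pi>\<^sub>M i\<in>{..<n}. lborel :: real measure)"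
  define Y where "Y = (\<lambda>(\<omega>, \<pi>). \<lambda>i\<in>{..<n}. eigenvalue_list (W \<omega>) ! \<pi> i)"
  interpret Q: prob_space Q unfolding Q_def by (rule prob_space_measure_pmf)
  interpret pair_sigma_finite M Q ..
  have dist: "distributed N L Y (\<lambda>x. ennreal (c * gue_weight n x))"
    using dens unfolding eigenvalues_have_density_def N_def Q_def L_def Y_def .
  have Y[measurable]: "Y \<in> measurable N L" using dist by (rule distributed_measurable)
  have distr: "distr N L Y = density L (\<lambda>x. ennreal (c * gue_weight n x))"
    using dist by (rule distributed_distr_eq_density)
  have wm[measurable]: "gue_weight n \<in> borel_measurable L" unfolding L_def by (rule gue_weight_measurable)
  have w0: "gue_weight n x \<ge> 0" for x unfolding gue_weight_def by (intro mult_nonneg_nonneg prod_nonneg) auto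
  define g where "g z x = exp (z * of_real (\<Sum>i<n. ln \<bar>x i\<bar>))" for z :: complex and x :: "nat \<Rightarrow> real"
  have comp[measurable]: "(\<lambda>x. x k) \<in> borel_measurable L" if "k < n" for k
    using measurable_component_singleton[of k "{..<n}" "\<lambda>_. lborel"] that by (simp add: L_def)
  have g_meas[measurable]: "g z \<in> borel_measurable L" for z
  proof -
    have "(\<lambda>x. \<Sum>i<n. ln \<bar>x i\<bar>) \<in> borel_measurable L"
      by (intro borel_measurable_sum borel_measurable_ln borel_measurable_abs comp) auto
    thus ?thesis unfolding g_def by measurable
  qed
  have gN: "integrable N (\<lambda>p. g z (Y p))" "(\<integral>p. g z (Y p) \<partial>N) = of_real c * (of_nat (fact n) * Determinant.det (hankel n z))"
    if z: "Re z \<ge> 0" for z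
  proof -
    have eq: "(c * gue_weight n x) *\<^sub>R g z x = of_real c * (of_real (gue_weight n x) * g z x)" for x
      by (simp add: scaleR_conv_of_real)
    have "integrable L (\<lambda>x. (c * gue_weight n x) *\<^sub>R g z x)"
      unfolding eq using gue_weight_mellin(1)[OF z, of n] unfolding g_def L_def by (rule integrable_mult_right)
    hence "integrable (distr N L Y) (g z)"
      unfolding distr using c w0 by (subst integrable_density) auto
    thus "integrable N (\<lambda>p. g z (Y p))" by (subst (asm) integrable_distr_eq) auto
    have "(\<integral>p. g z (Y p) \<partial>N) = (\<integral>x. g z x \<partial>distr N L Y)" by (rule integral_distr[symmetric]) auto
    also have "\<dots> = (\<integral>x. (c * gue_weight n x) *\<^sub>R g z x \<partial>L)"
      unfolding distr using c w0 by (intro integral_density) auto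
    also have "\<dots> = of_real c * (of_nat (fact n) * Determinant.det (hankel n z))"
      unfolding eq using gue_weight_mellin(2)[OF z, of n] by (simp add: g_def L_def)
    finally show "(\<integral>p. g z (Y p) \<partial>N) = of_real c * (of_nat (fact n) * Determinant.det (hankel n z))" .
  qed
  have nz: "AE p in N. \<forall>i<n. Y p i \<noteq> 0"
  proof -
    have a: "AE x in L. \<forall>i<n. x i \<noteq> 0" unfolding L_def by (rule AE_PiM_lborel_nonzero)
    have m: "(\<lambda>x. ennreal (c * gue_weight n x)) \<in> borel_measurable L" by measurable
    have "AE x in distr N L Y. \<forall>i<n. x i \<noteq> 0"
      unfolding distr AE_density[OF m] by (rule eventually_mono[OF a]) auto
    thus ?thesis by (rule AE_distrD[OF Y])
  qed
  have perm: "AE p in N. snd p permutes {..<n}"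
  proof -
    have fin: "finite {\<pi>. \<pi> permutes {..<n}}" by (rule finite_permutations) simp
    have "id \<in> {\<pi>. \<pi> permutes {..<n}}" by (simp add: permutes_id)
    hence ne: "{\<pi>. \<pi> permutes {..<n}} \<noteq> {}" by blast
    have "AE \<pi> in Q. \<pi> permutes {..<n}"
      unfolding Q_def by (rule AE_pmfI) (use fin ne in \<open>simp add: set_pmf_of_set\<close>)
    moreover have "{p \<in> space N. snd p permutes {..<n}} \<in> sets N"
    proof -
      have "snd -` {\<pi>. \<pi> permutes {..<n}} \<inter> space N \<in> sets N"
        unfolding N_def by (rule measurable_sets[OF measurable_snd]) (simp add: Q_def)
      also have "snd -` {\<pi>. \<pi> permutes {..<n}} \<inter> space N = {p \<in> space N. snd p permutes {..<n}}" by auto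
      finally show ?thesis .
    qed
    ultimately show ?thesis unfolding N_def by (intro AE_pair_measure) auto
  qed
  have XY: "AE p in N. exp (z * of_real (X (fst p))) = exp (- z * of_real (gue_mu n)) * g z (Y p)" for z
    using AE_space nz perm
  proof eventually_elim
    fix p assume p: "p \<in> space N" "\<forall>i<n. Y p i \<noteq> 0" "snd p permutes {..<n}"
    obtain \<omega> \<pi> where p_eq: "p = (\<omega>, \<pi>)" by (cases p)
    have \<omega>: "\<omega> \<in> space M" and \<pi>: "\<pi> permutes {..<n}" using p by (auto simp: p_eq N_def space_pair_measure)
    have "cmod (Determinant.det (W \<omega>)) = (\<Prod>i<n. \<bar>eigenvalue_list (W \<omega>) ! i\<bar>)"
      by (rule hermitian_abs_det(2)[OF W[OF \<omega>]])
    also have "\<dots> = (\<Prod>i<n. \<bar>eigenvalue_list (W \<omega>) ! \<pi> i\<bar>)"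
      using prod.permute[OF \<pi>, of "\<lambda>i. \<bar>eigenvalue_list (W \<omega>) ! i\<bar>"] by (simp add: o_def)
    also have "\<dots> = (\<Prod>i<n. \<bar>Y p i\<bar>)" by (simp add: Y_def p_eq)
    also have "ln \<dots> = (\<Sum>i<n. ln \<bar>Y p i\<bar>)" using p(2) by (subst ln_prod) auto
    finally have XS: "X \<omega> = (\<Sum>i<n. ln \<bar>Y p i\<bar>) - gue_mu n" by (simp add: X_def log_det_centered_def)
    have "z * of_real (X \<omega>) = - z * of_real (gue_mu n) + z * of_real (\<Sum>i<n. ln \<bar>Y p i\<bar>)"
      unfolding XS of_real_diff by (simp add: right_diff_distrib del: of_real_sum)
    hence "exp (z * of_real (X \<omega>)) = exp (- z * of_real (gue_mu n)) * g z (Y p)"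
      by (simp only: exp_add g_def)
    thus "exp (z * of_real (X (fst p))) = exp (- z * of_real (gue_mu n)) * g z (Y p)"
      by (simp add: p_eq)
  qed
  have fst: "distr N M fst = M" unfolding N_def by (rule Q.distr_pair_fst)
  have m1: "(\<lambda>p. exp (z * of_real (X (fst p)))) \<in> borel_measurable N" for z :: complex
    unfolding N_def by measurable
  have m2: "(\<lambda>\<omega>. exp (z * of_real (X \<omega>))) \<in> borel_measurable M" for z :: complex by measurable
  have m3: "(\<lambda>p. exp (- z * of_real (gue_mu n)) * g z (Y p)) \<in> borel_measurable N" for z :: complex by measurable
  have m4: "fst \<in> measurable N M" unfolding N_def by simp
  have int: "integrable M (\<lambda>\<omega>. exp (z * of_real (X \<omega>)))"
    and val: "(\<integral>\<omega>. exp (z * of_real (X \<omega>)) \<partial>M) =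
        exp (- z * of_real (gue_mu n)) * (of_real c * (of_nat (fact n) * Determinant.det (hankel n z)))"
    if z: "Re z \<ge> 0" for z
  proof -
    have "integrable N (\<lambda>p. exp (- z * of_real (gue_mu n)) * g z (Y p))"
      by (intro integrable_mult_right gN z)
    hence "integrable N (\<lambda>p. exp (z * of_real (X (fst p))))"
      by (subst integrable_cong_AE[OF m1 m3 XY])
    hence "integrable (distr N M fst) (\<lambda>\<omega>. exp (z * of_real (X \<omega>)))"
      by (subst integrable_distr_eq[OF m4 m2])
    thus "integrable M (\<lambda>\<omega>. exp (z * of_real (X \<omega>)))" by (simp only: fst)
    have "(\<integral>\<omega>. exp (z * of_real (X \<omega>)) \<partial>M) = (\<integral>\<omega>. exp (z * of_real (X \<omega>)) \<partial>distr N M fst)" by (simp only: fst)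
    also have "\<dots> = (\<integral>p. exp (z * of_real (X (fst p))) \<partial>N)" by (rule integral_distr[OF m4 m2])
    also have "\<dots> = (\<integral>p. exp (- z * of_real (gue_mu n)) * g z (Y p) \<partial>N)"
      by (rule integral_cong_AE[OF m1 m3 XY])
    also have "\<dots> = exp (- z * of_real (gue_mu n)) * (of_real c * (of_nat (fact n) * Determinant.det (hankel n z)))"
      using gN(2)[OF z] by simp
    finally show "(\<integral>\<omega>. exp (z * of_real (X \<omega>)) \<partial>M) =
        exp (- z * of_real (gue_mu n)) * (of_real c * (of_nat (fact n) * Determinant.det (hankel n z)))" .
  qed
  show "integrable M (\<lambda>\<omega>. exp (z * of_real (X \<omega>)))" if "Re z \<ge> 0" using int[OF that] .
  obtain d where d: "\<And>z. Re z \<ge> 0 \<Longrightarrow> Determinant.det (hankel n z) = d * (\<Prod>k=1..n. gauss_mellin (z + 2 * of_nat (k div 2)))"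
    using det_hankel by blast
  let ?e = "of_real c * (of_nat (fact n) * d)"
  let ?P0 = "\<Prod>k=1..n. gauss_mellin (2 * of_nat (k div 2))"
  have "1 = ?e * ?P0" using val[of 0] d[of 0] M.prob_space by (simp add: mult.assoc)
  hence e: "?e = 1 / ?P0" by (metis mult_zero_right nonzero_eq_divide_eq zero_neq_one)
  show "(\<integral>\<omega>. exp (z * of_real (X \<omega>)) \<partial>M) = gue_mgf n z" if z: "Re z \<ge> 0"
  proof -
    have "(\<integral>\<omega>. exp (z * of_real (X \<omega>)) \<partial>M) = exp (- z * of_real (gue_mu n)) * (?e * (\<Prod>k=1..n. gauss_mellin (z + 2 * of_nat (k div 2))))"
      unfolding val[OF z] d[OF z] by (simp only: mult_ac)
    also have "\<dots> = gue_mgf n z" unfolding e gue_mgf_def by (simp add: prod_dividef)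
    finally show ?thesis .
  qed
qed

section \<open>The cumulant generating function is quadratic up to a Lipschitz error\<close>

text \<open>
  Compare \<open>\<psi>'(a + v) = \<Sum>k. 1 / (a + v + k)\<^sup>2\<close> termwise with the telescoping series
  \<open>1/a = \<Sum>k. 1 / ((a + k) (a + k + 1))\<close>: the difference of the terms is smaller by a factor of order
  \<open>1 / a\<close>.
\<close>

lemma trigamma_close:
  fixes v :: complex and a :: real
  assumes a: "a \<ge> 1 / 2" and v: "Re v \<ge> 0" "cmod v \<le> 1"
  shows "cmod (Polygamma 1 (of_real a + v) - of_real (1 / a)) \<le> 5 / a\<^sup>2"
proof -
  let ?w = "of_real a + v"
  have w: "?w \<noteq> 0" using a v by (auto simp: complex_eq_iff)
  have lim: "(\<lambda>k. 1 / (a + real k)) \<longlonglongrightarrow> 0" by real_asymp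
  have T: "(\<lambda>k. 1 / (a + real k) - 1 / (a + real (Suc k))) sums (1 / a)"
    using telescope_sums'[OF lim] by simp
  have P: "(\<lambda>k. inverse ((?w + of_nat k)\<^sup>2)) sums Polygamma 1 ?w"
    using Polygamma_LIMSEQ[OF w, of 1] by (simp add: numeral_2_eq_2)
  have S: "(\<lambda>k. inverse ((?w + of_nat k)\<^sup>2) - of_real (1 / (a + real k) - 1 / (a + real (Suc k)))) sums
             (Polygamma 1 ?w - of_real (1 / a))"
    by (intro sums_diff P sums_of_real T)
  have G: "(\<lambda>k. 5 / a * (1 / (a + real k) - 1 / (a + real (Suc k)))) sums (5 / a * (1 / a))"
    by (intro sums_mult T)
  have "cmod (Polygamma 1 ?w - of_real (1 / a)) \<le> 5 / a * (1 / a)"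
  proof (rule norm_sums_le[OF S G])
    fix k
    define b where "b = a + real k"
    have b: "b \<ge> a" "b \<ge> 1 / 2" "b > 0" using a by (auto simp: b_def)
    have wk: "?w + of_nat k = of_real b + v" by (simp add: b_def)
    have tel: "1 / (a + real k) - 1 / (a + real (Suc k)) = 1 / (b * (b + 1))"
      using b by (simp add: b_def field_simps)
    have bv: "cmod (of_real b + v) \<ge> b" using v complex_Re_le_cmod[of "of_real b + v"] by simp
    hence nz: "of_real b + v \<noteq> 0" using b by auto
    have nz2: "complex_of_real (b * (b + 1)) \<noteq> 0" using b by (simp del: of_real_mult of_real_add)
    have "inverse ((of_real b + v)\<^sup>2) - of_real (1 / (b * (b + 1)))
        = (of_real (b * (b + 1)) - (of_real b + v)\<^sup>2) / ((of_real b + v)\<^sup>2 * of_real (b * (b + 1)))"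
      using nz nz2 by (simp add: field_simps)
    also have "of_real (b * (b + 1)) - (of_real b + v)\<^sup>2 = of_real b - of_real (2 * b) * v - v\<^sup>2"
      by (simp add: power2_eq_square algebra_simps)
    finally have "cmod (inverse ((of_real b + v)\<^sup>2) - of_real (1 / (b * (b + 1))))
       = cmod (of_real b - of_real (2 * b) * v - v\<^sup>2) / ((cmod (of_real b + v))\<^sup>2 * (b * (b + 1)))"
      using b by (simp add: norm_divide norm_mult norm_power del: of_real_mult of_real_add)
    also have "cmod (of_real b - of_real (2 * b) * v - v\<^sup>2) \<le> b + 2 * b * 1 + 1"
    proof -
      have "cmod (of_real b - of_real (2 * b) * v - v\<^sup>2) \<le> cmod (of_real b) + cmod (of_real (2 * b) * v) + cmod (v\<^sup>2)"
        by (intro order_trans[OF norm_triangle_ineq4] add_mono order_refl)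
      also have "\<dots> \<le> b + 2 * b * 1 + 1"
        using b v by (intro add_mono) (auto simp: norm_mult norm_power power_le_one)
      finally show ?thesis .
    qed
    also have "\<dots> \<le> 5 * b" using b by simp
    finally have "cmod (inverse ((of_real b + v)\<^sup>2) - of_real (1 / (b * (b + 1))))
       \<le> 5 * b / ((cmod (of_real b + v))\<^sup>2 * (b * (b + 1)))"
      using b by (simp add: divide_right_mono)
    also have "\<dots> \<le> 5 * b / (b\<^sup>2 * (b * (b + 1)))"
      using b bv nz by (intro divide_left_mono mult_right_mono power_mono mult_pos_pos) auto
    also have "\<dots> = 5 / b * (1 / (b * (b + 1)))"
      using b by (simp add: power2_eq_square)
    also have "\<dots> \<le> 5 / a * (1 / (b * (b + 1)))"
      using b a by (intro mult_right_mono divide_left_mono) auto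
    finally show "cmod (inverse ((?w + of_nat k)\<^sup>2) - of_real (1 / (a + real k) - 1 / (a + real (Suc k))))
        \<le> 5 / a * (1 / (a + real k) - 1 / (a + real (Suc k)))"
      unfolding wk tel .
  qed
  thus ?thesis by (simp add: power2_eq_square)
qed

text \<open>
  Half the number of degrees of freedom of the \<open>k\<close>-th chi variable, the argument of its Gamma function.
\<close>

definition half_dof :: "nat \<Rightarrow> real" where "half_dof k = real (k div 2) + 1 / 2"

lemma half_dof_bounds: "half_dof k \<ge> 1 / 2" "half_dof k \<ge> real k / 2" "half_dof k \<le> (real k + 1) / 2"
proof -
  have "real (2 * (k div 2)) \<ge> real k - 1" "real (2 * (k div 2)) \<le> real k"
    by linarith+
  thus "half_dof k \<ge> 1 / 2" "half_dof k \<ge> real k / 2" "half_dof k \<le> (real k + 1) / 2"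
    by (auto simp: half_dof_def)
qed

lemma sum_inverse_squares_le: "n \<ge> 1 \<Longrightarrow> (\<Sum>k=1..n. 1 / (real k)\<^sup>2) \<le> 2 - 1 / real n"
proof (induction n rule: nat_induct_at_least)
  case (Suc n)
  have "1 / (real (Suc n))\<^sup>2 \<le> 1 / (real n * real (Suc n))"
    using Suc unfolding power2_eq_square by (intro divide_left_mono mult_right_mono) auto
  also have "\<dots> = 1 / real n - 1 / real (Suc n)"
    using Suc by (simp add: divide_simps)
  finally have "1 / (real (Suc n))\<^sup>2 \<le> 1 / real n - 1 / real (Suc n)" .
  with Suc show ?case by simp
qed simp

text \<open>
  Each term \<open>1 / half_dof k\<close> is \<open>2 / k\<close> up to a summable error, so the sum is twice a harmonic number.
\<close>

lemma sum_inverse_half_dof: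
  assumes n: "n \<ge> 1"
  shows "\<bar>(\<Sum>k=1..n. 1 / half_dof k) - 2 * ln (real n)\<bar> \<le> 6"
    and "(\<Sum>k=1..n. 5 / (half_dof k)\<^sup>2) \<le> 40"
proof -
  have sq: "(\<Sum>k=1..n. 1 / (real k)\<^sup>2) \<le> 2" using sum_inverse_squares_le[OF n] by (smt (verit) divide_nonneg_nonneg of_nat_0_le_iff)
  have "(\<Sum>k=1..n. 5 / (half_dof k)\<^sup>2) \<le> (\<Sum>k=1..n. 20 * (1 / (real k)\<^sup>2))"
  proof (rule sum_mono)
    fix k assume "k \<in> {1..n}"
    hence k: "k \<ge> 1" by simp
    have "(real k / 2)\<^sup>2 \<le> (half_dof k)\<^sup>2" using half_dof_bounds(2)[of k] by (intro power_mono) auto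
    hence "5 / (half_dof k)\<^sup>2 \<le> 5 / (real k / 2)\<^sup>2" using k half_dof_bounds(1)[of k] by (intro divide_left_mono) auto
    thus "5 / (half_dof k)\<^sup>2 \<le> 20 * (1 / (real k)\<^sup>2)" by (simp add: power_divide)
  qed
  also have "\<dots> = 20 * (\<Sum>k=1..n. 1 / (real k)\<^sup>2)" by (simp add: sum_distrib_left)
  finally show "(\<Sum>k=1..n. 5 / (half_dof k)\<^sup>2) \<le> 40" using sq by linarith
  have "\<bar>(\<Sum>k=1..n. 1 / half_dof k) - 2 * harm n\<bar> = \<bar>\<Sum>k=1..n. (1 / half_dof k - 2 / real k)\<bar>"
    by (simp add: sum_subtractf harm_def sum_distrib_left inverse_eq_divide)
  also have "\<dots> \<le> (\<Sum>k=1..n. \<bar>1 / half_dof k - 2 / real k\<bar>)" by (rule sum_abs)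
  also have "\<dots> \<le> (\<Sum>k=1..n. 2 * (1 / (real k)\<^sup>2))"
  proof (rule sum_mono)
    fix k assume "k \<in> {1..n}"
    hence k: "real k \<ge> 1" by simp
    have "1 / half_dof k \<le> 1 / (real k / 2)" using k half_dof_bounds[of k] by (intro divide_left_mono) auto
    moreover have "1 / half_dof k \<ge> 1 / ((real k + 1) / 2)" using k half_dof_bounds[of k] by (intro divide_left_mono) auto
    moreover have "2 / real k - 2 / (real k + 1) \<le> 2 * (1 / (real k)\<^sup>2)"
    proof -
      have "2 / real k - 2 / (real k + 1) = 2 / (real k * (real k + 1))" using k by (simp add: divide_simps)
      also have "\<dots> \<le> 2 / (real k * real k)" using k by (intro divide_left_mono mult_left_mono) auto
      finally show ?thesis by (simp add: power2_eq_square)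
    qed
    ultimately show "\<bar>1 / half_dof k - 2 / real k\<bar> \<le> 2 * (1 / (real k)\<^sup>2)" using k by simp
  qed
  also have "\<dots> = 2 * (\<Sum>k=1..n. 1 / (real k)\<^sup>2)" by (simp add: sum_distrib_left)
  finally have 1: "\<bar>(\<Sum>k=1..n. 1 / half_dof k) - 2 * harm n\<bar> \<le> 4" using sq by linarith
  have "harm n - ln (real n) \<le> harm 1 - ln (real 1)" using n by (intro euler_mascheroni_sequence_decreasing) auto
  moreover have "harm n - ln (real n) \<ge> 0"
    using harm_ge_ln[of n] ln_le_cancel_iff[of "real n" "real n + 1"] n by linarith
  ultimately have "\<bar>harm n - ln (real n)\<bar> \<le> 1" by (simp add: harm_def)
  with 1 show "\<bar>(\<Sum>k=1..n. 1 / half_dof k) - 2 * ln (real n)\<bar> \<le> 6" by linarith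
qed

lemma ln_half_dof_ratio: "ln (2 * half_dof m / real m) = (1 + (-1) ^ m) / 2 * ln (1 + 1 / real m)" if "m \<ge> 1"
proof (cases "even m")
  case True
  then obtain j where "m = 2 * j" by (elim evenE)
  thus ?thesis using that by (simp add: half_dof_def add_divide_distrib)
next
  case False
  then obtain j where "m = 2 * j + 1" by (elim oddE)
  thus ?thesis by (simp add: half_dof_def)
qed

text \<open>
  The sum is \<open>ln E |det W|\<^sup>2\<close>. The increments of its difference to the asymptotic expression are
  \<open>\<plusminus> 1/(2m)\<close> with alternating sign plus \<open>O (1/m\<^sup>2)\<close>; subtracting \<open>(-1)\<^sup>n / (4n)\<close> removes the
  alternating part, and a sequence with summable increments is bounded.
\<close>

lemma sum_ln_half_dof:
  "\<exists>C. \<forall>n\<ge>1. \<bar>(\<Sum>k=1..n. ln (2 * half_dof k)) - (real n * ln (real n) - real n + ln (real n))\<bar> \<le> C"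
proof -
  define e where "e n = (\<Sum>k=1..n. ln (2 * half_dof k)) - (real n * ln (real n) - real n + ln (real n))" for n
  \<comment> \<open>the partial sums of the alternating part of the increments, up to summable terms\<close>
  define c where "c n = (-1) ^ n / (4 * real n)" for n
  define f where "f i = e (Suc i) - c (Suc i)" for i
  define A where "A m = real m * ln (1 - 1 / real m) + 1 + ln (1 + 1 / real m) / 2" for m :: nat
  define B where "B m = ln (1 + 1 / real m) / 2 - (1 / (4 * real m) + 1 / (4 * (real m - 1)))" for m :: nat
  have step: "f (Suc i) - f i = A (Suc (Suc i)) + (-1) ^ i * B (Suc (Suc i))" for i
  proof -
    define m where "m = Suc (Suc i)"
    have m: "m \<ge> 2" "real m \<ge> 2" by (auto simp: m_def)
    have i: "real (Suc i) = real m - 1" by (simp add: m_def)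
    have d: "2 * half_dof m / real m > 0" using half_dof_bounds(1)[of m] m by (intro divide_pos_pos) auto
    have "e m - e (Suc i) = ln (2 * half_dof m) - (real m * ln (real m) - real m + ln (real m))
        + ((real m - 1) * ln (real m - 1) - (real m - 1) + ln (real m - 1))"
      unfolding e_def i by (simp add: m_def)
    also have "ln (2 * half_dof m) = ln (2 * half_dof m / real m) + ln (real m)"
      using d m half_dof_bounds(1)[of m] by (simp add: ln_div)
    also have "ln (real m - 1) = ln (real m) + ln (1 - 1 / real m)"
    proof -
      have "real m - 1 = real m * (1 - 1 / real m)" using m by (simp add: field_simps)
      thus ?thesis using m by (simp add: ln_mult)
    qed
    finally have "e m - e (Suc i) = ln (2 * half_dof m / real m) + real m * ln (1 - 1 / real m) + 1"
      by (simp add: algebra_simps)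
    also have "\<dots> = A m + (-1) ^ m * (ln (1 + 1 / real m) / 2)"
      using ln_half_dof_ratio[of m] m by (simp add: A_def field_simps)
    finally have "e m - e (Suc i) = A m + (-1) ^ m * (ln (1 + 1 / real m) / 2)" .
    moreover have "c m - c (Suc i) = (-1) ^ m * (1 / (4 * real m) + 1 / (4 * (real m - 1)))"
      unfolding c_def i by (simp add: m_def field_simps)
    moreover have "(-1) ^ m = ((-1) ^ i :: real)" by (simp add: m_def)
    ultimately show ?thesis by (simp add: f_def m_def B_def algebra_simps)
  qed
  have "A \<in> O(\<lambda>m. 1 / real m ^ 2)" unfolding A_def by real_asymp
  hence sA: "summable A"
    by (rule summable_comparison_test_bigo[rotated]) (use inverse_power_summable[of 2, where ?'a = real] in \<open>simp add: inverse_eq_divide\<close>)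
  have "B \<in> O(\<lambda>m. 1 / real m ^ 2)" unfolding B_def by real_asymp
  moreover have s2: "summable (\<lambda>m. norm (1 / real m ^ 2))"
    using inverse_power_summable[of 2, where ?'a = real] by (simp add: inverse_eq_divide)
  ultimately have "summable (\<lambda>m. norm (B m))"
    by (intro summable_comparison_test_bigo[OF s2]) simp
  hence sB: "summable (\<lambda>i. (-1) ^ i * B (Suc (Suc i)))"
  proof -
    assume "summable (\<lambda>m. norm (B m))"
    hence "summable (\<lambda>i. norm (B (i + 2)))" by (rule summable_ignore_initial_segment)
    thus ?thesis by (intro summable_norm_cancel[of "\<lambda>i. (-1) ^ i * B (Suc (Suc i))"]) (simp add: abs_mult)
  qed
  have sA': "summable (\<lambda>i. A (Suc (Suc i)))" using summable_ignore_initial_segment[OF sA, of 2] by simp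
  have "summable (\<lambda>i. f (Suc i) - f i)" unfolding step by (intro summable_add sA' sB)
  hence "convergent (\<lambda>n. \<Sum>i<n. f (Suc i) - f i)" by (simp add: summable_iff_convergent)
  hence "convergent (\<lambda>n. f n - f 0)" by (simp add: sum_lessThan_telescope)
  hence "convergent (\<lambda>n. (f n - f 0) + f 0)" by (intro convergent_add convergent_const)
  hence "Bseq f" by (simp add: convergent_imp_Bseq)
  then obtain K where K: "\<And>i. \<bar>f i\<bar> \<le> K" by (auto simp: Bseq_def)
  show ?thesis
  proof (intro exI allI impI)
    fix n :: nat assume n: "n \<ge> 1"
    have "\<bar>c n\<bar> \<le> 1" using n by (simp add: c_def abs_mult power_abs field_simps)
    moreover have "\<bar>e n - c n\<bar> \<le> K" using K[of "n - 1"] n by (simp add: f_def)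
    ultimately show "\<bar>(\<Sum>k=1..n. ln (2 * half_dof k)) - (real n * ln (real n) - real n + ln (real n))\<bar> \<le> K + 1"
      unfolding e_def by linarith
  qed
qed

text \<open>
  The branch of the logarithm of \<open>gue_mgf\<close> that is built from \<open>ln_Gamma\<close>; it is holomorphic on the
  right half plane and vanishes at 0.
\<close>

definition gue_log_mgf :: "nat \<Rightarrow> complex \<Rightarrow> complex" where
  "gue_log_mgf n z = (\<Sum>k=1..n. z / 2 * of_real (ln 2) +
     (ln_Gamma (of_real (half_dof k) + z / 2) - ln_Gamma (of_real (half_dof k)))) - z * of_real (gue_mu n)"

text \<open>
  What is left of the cumulant generating function after removing the Gaussian part
  \<open>s\<^sup>2 z\<^sup>2 / 2\<close> with \<open>s\<^sup>2 = ln (n/2) / 2\<close>.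
\<close>

definition gue_rest :: "nat \<Rightarrow> complex \<Rightarrow> complex" where
  "gue_rest n z = gue_log_mgf n z - of_real (ln (real n / 2) / 4) * z\<^sup>2"

lemma Re_pos_not_nonpos:
  assumes "Re w > 0"
  shows "w \<notin> \<real>\<^sub>\<le>\<^sub>0" "w \<notin> \<int>\<^sub>\<le>\<^sub>0"
  using assms by (auto elim!: nonpos_Ints_cases' simp: complex_nonpos_Reals_iff)

lemma exp_ln_Gamma_Re_pos: "Re w > 0 \<Longrightarrow> exp (ln_Gamma w) = Gamma (w :: complex)"
  using Gamma_complex_altdef[of w] by (auto elim!: nonpos_Ints_cases')

lemma gue_mgf_eq_exp:
  assumes z: "Re z \<ge> 0"
  shows "gue_mgf n z = exp (gue_log_mgf n z)"
proof -
  have factor: "gauss_mellin (z + 2 * of_nat (k div 2)) / gauss_mellin (2 * of_nat (k div 2)) =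
     exp (z / 2 * of_real (ln 2) + (ln_Gamma (of_real (half_dof k) + z / 2) - ln_Gamma (of_real (half_dof k))))" for k
  proof -
    let ?a = "complex_of_real (half_dof k)"
    have a: "half_dof k > 0" using half_dof_bounds(1)[of k] by linarith
    have ln2: "Ln 2 = complex_of_real (ln 2)" using Ln_of_real[of 2] by simp
    have 1: "(z + 2 * of_nat (k div 2) + 1) / 2 = ?a + z / 2" "(2 * of_nat (k div 2) + 1) / 2 = ?a"
      by (simp_all add: half_dof_def field_simps)
    have 2: "Re (?a + z / 2) > 0" "Re ?a > 0" using a z by auto
    have "gauss_mellin (z + 2 * of_nat (k div 2)) / gauss_mellin (2 * of_nat (k div 2)) =
        (exp ((?a + z / 2) * of_real (ln 2)) * exp (ln_Gamma (?a + z / 2))) / (exp (?a * of_real (ln 2)) * exp (ln_Gamma ?a))"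
      unfolding gauss_mellin_def 1 exp_ln_Gamma_Re_pos[OF 2(1)] exp_ln_Gamma_Re_pos[OF 2(2)] by (simp add: powr_def ln2)
    also have "\<dots> = exp (((?a + z / 2) * of_real (ln 2) + ln_Gamma (?a + z / 2)) - (?a * of_real (ln 2) + ln_Gamma ?a))"
      by (simp only: exp_add exp_diff)
    also have "((?a + z / 2) * of_real (ln 2) + ln_Gamma (?a + z / 2)) - (?a * of_real (ln 2) + ln_Gamma ?a)
      = z / 2 * of_real (ln 2) + (ln_Gamma (?a + z / 2) - ln_Gamma ?a)" by (simp add: algebra_simps)
    finally show ?thesis .
  qed
  show ?thesis unfolding gue_mgf_def gue_log_mgf_def factor
    by (simp add: exp_diff exp_minus exp_sum field_simps)
qed

lemma gue_rest_0: "gue_rest n 0 = 0"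
  by (simp add: gue_rest_def gue_log_mgf_def)

text \<open>
  At \<open>z = 2\<close> the Gamma quotients collapse, which makes the value explicit.
\<close>

lemma gue_rest_2:
  assumes "n \<ge> 1"
  shows "gue_rest n 2 = of_real ((\<Sum>k=1..n. ln (2 * half_dof k)) - (real n * ln (real n) - real n + ln (real n)) - ln pi)"
proof -
  have "2 / 2 * complex_of_real (ln 2) + (ln_Gamma (of_real (half_dof k) + 2 / 2) - ln_Gamma (of_real (half_dof k)))
     = of_real (ln (2 * half_dof k))" for k
  proof -
    have a: "half_dof k > 0" using half_dof_bounds(1)[of k] by linarith
    have "ln_Gamma (half_dof k + 1) = ln (half_dof k * Gamma (half_dof k))"
      using a Gamma_plus1[of "half_dof k"] nonpos_Ints_nonpos[of "half_dof k"]
      by (subst ln_Gamma_real_pos) auto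
    also have "\<dots> = ln (half_dof k) + ln_Gamma (half_dof k)"
    proof -
      have "Gamma (half_dof k) \<noteq> 0" using Gamma_real_pos[OF a] by linarith
      thus ?thesis using a by (simp add: ln_mult ln_Gamma_real_pos)
    qed
    finally have "ln_Gamma (half_dof k + 1) = ln (half_dof k) + ln_Gamma (half_dof k)" .
    moreover have "ln_Gamma (complex_of_real (half_dof k) + 2 / 2) = of_real (ln_Gamma (half_dof k + 1))"
      using ln_Gamma_complex_of_real[of "half_dof k + 1"] a by simp
    moreover have "ln_Gamma (complex_of_real (half_dof k)) = of_real (ln_Gamma (half_dof k))"
      using a by (rule ln_Gamma_complex_of_real)
    ultimately show ?thesis using a by (simp add: ln_mult)
  qed
  hence "gue_rest n 2 = of_real ((\<Sum>k=1..n. ln (2 * half_dof k)) - 2 * gue_mu n - ln (real n / 2))"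
    unfolding gue_rest_def gue_log_mgf_def by simp
  also have "(\<Sum>k=1..n. ln (2 * half_dof k)) - 2 * gue_mu n - ln (real n / 2) = (\<Sum>k=1..n. ln (2 * half_dof k)) - (real n * ln (real n) - real n + ln (real n)) - ln pi"
    using assms by (simp add: gue_mu_def ln_div ln_mult field_simps)
  finally show ?thesis .
qed

text \<open>
  Only the right half is used, because there the Gamma arguments stay away from the poles for every
  \<open>n\<close>. The point 2 belongs to it, which allows a comparison with the explicit second moment.
\<close>

definition half_disc :: "complex set" where "half_disc = {z. Re z \<ge> 0} \<inter> cball 0 2"

text \<open>
  The second derivative is bounded by the trigamma estimate. The first derivative at 0 is then
  controlled by the values at the two points 0 and 2: between them the function differs from its
  tangent at 0 by a bounded amount.
\<close>

lemma gue_rest_lipschitz: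
  obtains C where "C \<ge> 0" "\<And>n z w. n \<ge> 1 \<Longrightarrow> z \<in> half_disc \<Longrightarrow> w \<in> half_disc \<Longrightarrow>
     cmod (gue_rest n z - gue_rest n w) \<le> C * cmod (z - w)"
proof -
  obtain C0 where C0: "\<And>n. n \<ge> 1 \<Longrightarrow> \<bar>(\<Sum>k=1..n. ln (2 * half_dof k)) - (real n * ln (real n) - real n + ln (real n))\<bar> \<le> C0"
    using sum_ln_half_dof by blast
  have cvx: "convex half_disc" unfolding half_disc_def
    by (intro convex_Int convex_cball convex_halfspace_Re_ge)
  have in_disc: "0 \<in> half_disc" "2 \<in> half_disc" by (auto simp: half_disc_def)
  define L where "L = C0 + \<bar>ln pi\<bar> + 100"
  have main: "cmod (gue_rest n z - gue_rest n w) \<le> L * cmod (z - w)" if n: "n \<ge> 1" and z: "z \<in> half_disc" and w: "w \<in> half_disc" for n z w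
  proof -
    define s2 where "s2 = ln (real n / 2) / 2"
    define G1 where "G1 z = (\<Sum>k=1..n. of_real (ln 2) / 2 + Digamma (of_real (half_dof k) + z / 2) / 2) - of_real (gue_mu n) - of_real s2 * z" for z :: complex
    define G2 where "G2 z = (\<Sum>k=1..n. Polygamma 1 (of_real (half_dof k) + z / 2) / 4) - of_real s2" for z :: complex
    have notin: "complex_of_real (half_dof k) + z / 2 \<notin> \<real>\<^sub>\<le>\<^sub>0" "complex_of_real (half_dof k) + z / 2 \<notin> \<int>\<^sub>\<le>\<^sub>0" if "z \<in> half_disc" for z k
    proof -
      have "Re (complex_of_real (half_dof k) + z / 2) > 0" using half_dof_bounds(1)[of k] that by (auto simp: half_disc_def)
      thus "complex_of_real (half_dof k) + z / 2 \<notin> \<real>\<^sub>\<le>\<^sub>0" "complex_of_real (half_dof k) + z / 2 \<notin> \<int>\<^sub>\<le>\<^sub>0"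
        by (rule Re_pos_not_nonpos)+
    qed
    have d1: "(gue_rest n has_field_derivative G1 z) (at z within half_disc)" if "z \<in> half_disc" for z
      unfolding gue_rest_def[abs_def] gue_log_mgf_def G1_def
      by (rule derivative_eq_intros refl notin that | simp add: s2_def sum.distrib)+
    have d2: "(G1 has_field_derivative G2 z) (at z within half_disc)" if "z \<in> half_disc" for z
      unfolding G1_def G2_def
      by (rule derivative_eq_intros refl notin that | simp)+
    have G2: "cmod (G2 z) \<le> 12" if "z \<in> half_disc" for z
    proof -
      have "G2 z = of_real ((\<Sum>k=1..n. 1 / half_dof k) / 4 - s2) + (\<Sum>k=1..n. (Polygamma 1 (of_real (half_dof k) + z / 2) - of_real (1 / half_dof k)) / 4)"
        unfolding G2_def by (simp add: sum_subtractf sum_divide_distrib diff_divide_distrib)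
      also have "cmod \<dots> \<le> \<bar>(\<Sum>k=1..n. 1 / half_dof k) / 4 - s2\<bar> + (\<Sum>k=1..n. (5 / (half_dof k)\<^sup>2) / 4)"
      proof (intro order_trans[OF norm_triangle_ineq] add_mono)
        show "cmod (of_real ((\<Sum>k=1..n. 1 / half_dof k) / 4 - s2)) \<le> \<bar>(\<Sum>k=1..n. 1 / half_dof k) / 4 - s2\<bar>"
          by (simp only: norm_of_real)
        have "cmod ((Polygamma 1 (of_real (half_dof k) + z / 2) - of_real (1 / half_dof k)) / 4) \<le> (5 / (half_dof k)\<^sup>2) / 4" for k
        proof -
          have "cmod (Polygamma 1 (of_real (half_dof k) + z / 2) - of_real (1 / half_dof k)) \<le> 5 / (half_dof k)\<^sup>2"
            by (rule trigamma_close[OF half_dof_bounds(1)]) (use that in \<open>auto simp: half_disc_def norm_divide\<close>)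
          thus ?thesis unfolding norm_divide by (simp add: divide_right_mono)
        qed
        thus "cmod (\<Sum>k=1..n. (Polygamma 1 (of_real (half_dof k) + z / 2) - of_real (1 / half_dof k)) / 4) \<le> (\<Sum>k=1..n. (5 / (half_dof k)\<^sup>2) / 4)"
          by (intro sum_norm_le) auto
      qed
      also have "(\<Sum>k=1..n. (5 / (half_dof k)\<^sup>2) / 4) \<le> 10"
        using sum_inverse_half_dof(2)[OF n] unfolding sum_divide_distrib[symmetric] by simp
      also have "\<bar>(\<Sum>k=1..n. 1 / half_dof k) / 4 - s2\<bar> \<le> 2"
      proof -
        have "s2 = ln (real n) / 2 - ln 2 / 2" using n by (simp add: s2_def ln_div diff_divide_distrib)
        moreover have "ln 2 \<le> (1::real)" using ln_le_minus_one[of 2] by simp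
        moreover have "ln 2 \<ge> (0::real)" by simp
        ultimately show ?thesis using sum_inverse_half_dof(1)[OF n] by linarith
      qed
      finally show ?thesis by simp
    qed
    have G1_diff: "cmod (G1 z - G1 0) \<le> 24" if "z \<in> half_disc" for z
    proof -
      have "cmod (G1 z - G1 0) \<le> 12 * cmod (z - 0)"
        by (rule field_differentiable_bound[OF cvx d2 G2]) (use that in_disc in auto)
      also have "\<dots> \<le> 12 * 2" using that by (intro mult_left_mono) (auto simp: half_disc_def)
      finally show ?thesis by simp
    qed
    \<comment> \<open>the deviation from the tangent at 0, evaluated at 2 to bound the derivative at 0\<close>
    define H where "H z = gue_rest n z - G1 0 * z" for z
    have dH: "(H has_field_derivative (G1 z - G1 0)) (at z within half_disc)" if "z \<in> half_disc" for z
      unfolding H_def by (rule derivative_eq_intros refl d1 that | simp)+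
    have "cmod (H 2 - H 0) \<le> 24 * cmod (2 - 0)"
      by (rule field_differentiable_bound[OF cvx dH G1_diff]) (use in_disc in auto)
    hence "cmod (gue_rest n 2 - G1 0 * 2) \<le> 48" by (simp add: H_def gue_rest_0)
    moreover have "cmod (gue_rest n 2) \<le> C0 + \<bar>ln pi\<bar>"
      unfolding gue_rest_2[OF n] norm_of_real using C0[OF n] by linarith
    moreover have "cmod (G1 0 * 2) \<le> cmod (gue_rest n 2) + cmod (gue_rest n 2 - G1 0 * 2)"
      by (metis norm_minus_commute norm_triangle_sub)
    ultimately have G10: "2 * cmod (G1 0) \<le> C0 + \<bar>ln pi\<bar> + 48" by (simp add: norm_mult)
    have G1: "cmod (G1 z) \<le> L" if "z \<in> half_disc" for z
    proof -
      have "cmod (G1 z) \<le> cmod (G1 0) + cmod (G1 z - G1 0)" by (metis norm_triangle_sub add.commute)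
      moreover have "cmod (G1 0) \<le> 2 * cmod (G1 0)" by simp
      ultimately show ?thesis using G1_diff[OF that] G10 unfolding L_def by linarith
    qed
    show ?thesis by (rule field_differentiable_bound[OF cvx d1 G1 z w])
  qed
  have "L \<ge> 0" using C0[of 1] unfolding L_def by linarith
  with main show ?thesis using that by blast
qed

section \<open>Decay on vertical lines and the tilted characteristic function\<close>

text \<open>
  In Euler's limit \<open>\<Gamma>(w) = lim n! n\<^sup>w / (w (w + 1) ... (w + n))\<close> the modulus of every factor of the
  denominator increases with the modulus of the imaginary part.
\<close>

lemma norm_Gamma_antimono:
  assumes a: "a > 0" and u: "\<bar>u\<bar> \<le> \<bar>v\<bar>"
  shows "cmod (Gamma (Complex a v)) \<le> cmod (Gamma (Complex a u))"
proof (rule LIMSEQ_le)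
  show "(\<lambda>n. cmod (Gamma_series (Complex a v) n)) \<longlonglongrightarrow> cmod (Gamma (Complex a v))"
       "(\<lambda>n. cmod (Gamma_series (Complex a u) n)) \<longlonglongrightarrow> cmod (Gamma (Complex a u))"
    by (intro tendsto_norm Gamma_series_LIMSEQ)+
  have "cmod (Gamma_series (Complex a v) n) \<le> cmod (Gamma_series (Complex a u) n)" for n
  proof -
    have eq: "cmod (Gamma_series (Complex a w) n) = fact n * exp (a * ln (real n)) / (\<Prod>i=0..<n + 1. cmod (Complex a w + of_nat i))" for w
      by (simp add: Gamma_series_def norm_divide norm_mult norm_fact pochhammer_prod prod_norm[symmetric] del: prod.op_ivl_Suc)
    have pos: "0 < cmod (Complex a w + of_nat i)" for i w
      using a by (auto simp: complex_eq_iff)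
    have "cmod (Complex a u + of_nat i) \<le> cmod (Complex a v + of_nat i)" for i
      using abs_le_square_iff[of u v] u by (simp add: cmod_def)
    hence "(\<Prod>i=0..<n + 1. cmod (Complex a u + of_nat i)) \<le> (\<Prod>i=0..<n + 1. cmod (Complex a v + of_nat i))"
      by (intro prod_mono) auto
    thus ?thesis unfolding eq using pos by (intro divide_left_mono mult_pos_pos prod_pos) auto
  qed
  thus "\<exists>N. \<forall>n\<ge>N. cmod (Gamma_series (Complex a v) n) \<le> cmod (Gamma_series (Complex a u) n)" by blast
qed

lemma norm_gauss_mellin_antimono:
  assumes h: "h \<ge> 0" and \<tau>: "\<bar>\<sigma>\<bar> \<le> \<bar>\<tau>\<bar>"
  shows "cmod (gauss_mellin (Complex h \<tau>)) \<le> cmod (gauss_mellin (Complex h \<sigma>))"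
proof -
  have eq: "cmod (gauss_mellin (Complex h t)) = exp ((h + 1) / 2 * ln 2) * cmod (Gamma (Complex ((h + 1) / 2) (t / 2)))" for t
  proof -
    have 1: "(Complex h t + 1) / 2 = Complex ((h + 1) / 2) (t / 2)" by (simp add: complex_eq_iff)
    have "Ln 2 = complex_of_real (ln 2)" using Ln_of_real[of 2] by simp
    hence "cmod (2 powr Complex ((h + 1) / 2) (t / 2)) = exp ((h + 1) / 2 * ln 2)" by (simp add: powr_def norm_exp_eq_Re)
    thus ?thesis unfolding gauss_mellin_def 1 norm_mult by simp
  qed
  show ?thesis unfolding eq using h \<tau> by (intro mult_left_mono norm_Gamma_antimono) auto
qed

text \<open>
  Two applications of the recurrence gain two factors of modulus at least \<open>|t|\<close>.
\<close>

lemma norm_gauss_mellin_decay: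
  assumes h: "0 \<le> h" "h \<le> 1" and t: "t \<noteq> 0"
  shows "cmod (gauss_mellin (Complex h t)) \<le> 8 / t\<^sup>2 * cmod (gauss_mellin (of_real h))"
proof -
  let ?z = "Complex h t"
  have step: "gauss_mellin (w + 4) = (w + 3) * ((w + 1) * gauss_mellin w)" if "Re w \<ge> 0" for w
    using gauss_mellin_recurrence[of "w + 2"] gauss_mellin_recurrence[of w] that by (simp add: add.assoc)
  have "t\<^sup>2 * cmod (gauss_mellin ?z) \<le> cmod (?z + 3) * cmod (?z + 1) * cmod (gauss_mellin ?z)"
  proof (intro mult_right_mono)
    have "\<bar>t\<bar> \<le> cmod (?z + 3)" "\<bar>t\<bar> \<le> cmod (?z + 1)"
      using abs_Im_le_cmod[of "?z + 3"] abs_Im_le_cmod[of "?z + 1"] by auto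
    hence "\<bar>t\<bar> * \<bar>t\<bar> \<le> cmod (?z + 3) * cmod (?z + 1)" by (intro mult_mono) auto
    thus "t\<^sup>2 \<le> cmod (?z + 3) * cmod (?z + 1)" by (simp add: power2_eq_square)
  qed simp
  also have "\<dots> = cmod (gauss_mellin (?z + 4))" using step[of ?z] h by (simp add: norm_mult)
  also have "\<dots> \<le> cmod (gauss_mellin (of_real h + 4))"
  proof -
    have "?z + 4 = Complex (h + 4) t" "of_real h + 4 = Complex (h + 4) 0" by (simp_all add: complex_eq_iff)
    thus ?thesis using norm_gauss_mellin_antimono[of "h + 4" 0 t] h by simp
  qed
  also have "\<dots> = (h + 3) * (h + 1) * cmod (gauss_mellin (of_real h))"
  proof -
    have "of_real h + 3 = complex_of_real (h + 3)" "of_real h + 1 = complex_of_real (h + 1)" by simp_all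
    hence "cmod (of_real h + 3) = h + 3" "cmod (of_real h + 1) = h + 1" using h by (simp_all only: norm_of_real)
    thus ?thesis using step[of "of_real h"] h by (simp add: norm_mult)
  qed
  also have "\<dots> \<le> 4 * 2 * cmod (gauss_mellin (of_real h))" using h by (intro mult_right_mono mult_mono) auto
  finally show ?thesis using t by (simp add: field_simps)
qed

lemma norm_gue_mgf:
  "cmod (gue_mgf n (Complex h t)) = exp (- h * gue_mu n) *
     (\<Prod>k=1..n. cmod (gauss_mellin (Complex (h + 2 * real (k div 2)) t)) / cmod (gauss_mellin (2 * of_nat (k div 2))))"
proof -
  have "Complex h t + 2 * of_nat (k div 2) = Complex (h + 2 * real (k div 2)) t" for k
    by (simp add: complex_eq_iff)
  thus ?thesis by (simp add: gue_mgf_def norm_mult norm_exp_eq_Re prod_norm[symmetric] norm_divide)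
qed

lemma norm_gue_mgf_antimono:
  assumes h: "h \<ge> 0" and "\<bar>\<sigma>\<bar> \<le> \<bar>\<tau>\<bar>"
  shows "cmod (gue_mgf n (Complex h \<tau>)) \<le> cmod (gue_mgf n (Complex h \<sigma>))"
  unfolding norm_gue_mgf using assms
  by (intro mult_left_mono prod_mono conjI divide_right_mono norm_gauss_mellin_antimono) auto

text \<open>
  The factor with index 1 already decays like \<open>1 / t\<^sup>2\<close>, and the other factors do not increase.
\<close>

lemma norm_gue_mgf_decay:
  assumes n: "n \<ge> 1" and h: "0 \<le> h" "h \<le> 1" and t: "t \<noteq> 0"
  shows "cmod (gue_mgf n (Complex h t)) \<le> 8 / t\<^sup>2 * cmod (gue_mgf n (of_real h))"
proof -
  let ?r = "\<lambda>t k. cmod (gauss_mellin (Complex (h + 2 * real (k div 2)) t)) / cmod (gauss_mellin (2 * of_nat (k div 2)))"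
  have split: "{1..n} = insert 1 {2..n}" using n by auto
  have "?r t 1 \<le> 8 / t\<^sup>2 * ?r 0 1"
    using divide_right_mono[OF norm_gauss_mellin_decay[OF h t], of "cmod (gauss_mellin 0)"] by (simp add: complex_of_real_def)
  moreover have "(\<Prod>k=2..n. ?r t k) \<le> (\<Prod>k=2..n. ?r 0 k)"
    using h by (intro prod_mono conjI divide_right_mono norm_gauss_mellin_antimono) auto
  ultimately have "?r t 1 * (\<Prod>k=2..n. ?r t k) \<le> (8 / t\<^sup>2 * ?r 0 1) * (\<Prod>k=2..n. ?r 0 k)"
    by (intro mult_mono prod_nonneg) auto
  hence "(\<Prod>k=1..n. ?r t k) \<le> 8 / t\<^sup>2 * (\<Prod>k=1..n. ?r 0 k)"
    unfolding split by simp
  hence "exp (- h * gue_mu n) * (\<Prod>k=1..n. ?r t k) \<le> exp (- h * gue_mu n) * (8 / t\<^sup>2 * (\<Prod>k=1..n. ?r 0 k))"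
    by (rule mult_left_mono) simp
  thus ?thesis unfolding complex_of_real_def norm_gue_mgf by (simp only: mult_ac)
qed

text \<open>
  Brings Gaussian errors into the form \<open>1 / (1 + t\<^sup>2)\<close> that is also used for the polynomial tails.
\<close>

lemma exp_minus_half_square_le: "exp (- t\<^sup>2 / 2) \<le> 2 / (1 + t\<^sup>2)" for t :: real
proof -
  have "1 + t\<^sup>2 / 2 \<le> exp (t\<^sup>2 / 2)" by (rule exp_ge_add_one_self)
  moreover have "1 + t\<^sup>2 / 2 > 0" by (simp add: add_pos_nonneg)
  ultimately have "1 / exp (t\<^sup>2 / 2) \<le> 1 / (1 + t\<^sup>2 / 2)" by (intro divide_left_mono) auto
  also have "\<dots> = 2 / (2 + t\<^sup>2)" by (simp add: field_simps)
  also have "\<dots> \<le> 2 / (1 + t\<^sup>2)" by (intro divide_left_mono) (auto simp: add_pos_nonneg)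
  finally show ?thesis by (simp add: exp_minus field_simps)
qed

lemma norm_exp_minus_1_le: "cmod (exp w - 1) \<le> cmod w * exp (cmod w)"
proof -
  have "cmod (exp w - exp 0) \<le> exp (cmod w) * cmod (w - 0)"
  proof (rule field_differentiable_bound[of "cball 0 (cmod w)" exp exp])
    show "cmod (exp z) \<le> exp (cmod w)" if "z \<in> cball 0 (cmod w)" for z
      using that by (intro order_trans[OF norm_exp]) auto
  qed (auto intro!: derivative_eq_intros)
  thus ?thesis by (simp add: mult.commute)
qed

lemma half_disc_Complex: "0 \<le> h \<Longrightarrow> h \<le> 1 \<Longrightarrow> \<bar>t\<bar> \<le> 1 \<Longrightarrow> Complex h t \<in> half_disc"
proof -
  assume h: "0 \<le> h" "h \<le> 1" and t: "\<bar>t\<bar> \<le> 1"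
  have "cmod (Complex h t) \<le> \<bar>h\<bar> + \<bar>t\<bar>" using cmod_le[of "Complex h t"] by simp
  thus ?thesis using h t by (simp add: half_disc_def)
qed

definition gue_sd :: "nat \<Rightarrow> real" where "gue_sd n = sqrt (1/2 * ln (real n / 2))"

text \<open>
  For \<open>|t| \<le> s\<close> the exponent differs from the Gaussian one by an increment of \<open>gue_rest\<close> over a
  segment of length \<open>|t| / s\<close>. For \<open>|t| > s\<close> the modulus of the quotient is the geometric mean of two
  bounds: monotonicity reduces it to its value at height 1, which is of order \<open>exp (- s\<^sup>2 / 2)\<close>, and the
  decay of a single factor supplies \<open>8 s\<^sup>2 / t\<^sup>2\<close>. The last clause says that the prefactor of the tilted
  tail deviates from its Gaussian value only by the exponential of a quantity of order \<open>h\<close>.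
\<close>

lemma gue_tilted_char_close:
  obtains K where "K \<ge> 0"
    "\<And>n h t. n \<ge> 1 \<Longrightarrow> gue_sd n \<ge> 1 \<Longrightarrow> 0 \<le> h \<Longrightarrow> h \<le> 1 \<Longrightarrow>
      cmod (gue_mgf n (Complex h (t / gue_sd n)) / gue_mgf n (of_real h) * iexp (- (t * h * gue_sd n)) - exp (- (of_real t)\<^sup>2 / 2))
        \<le> K / gue_sd n * \<bar>t\<bar> / (1 + t\<^sup>2)"
    "\<And>n h. n \<ge> 1 \<Longrightarrow> gue_sd n \<ge> 1 \<Longrightarrow> 0 \<le> h \<Longrightarrow> h \<le> 1 \<Longrightarrow>
      \<exists>G. cmod G \<le> K * h \<and> gue_mgf n (of_real h) * of_real (exp (- (h * gue_sd n)\<^sup>2 / 2)) = exp G"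
proof -
  obtain C where C: "C \<ge> 0" "\<And>n z w. n \<ge> 1 \<Longrightarrow> z \<in> half_disc \<Longrightarrow> w \<in> half_disc \<Longrightarrow>
     cmod (gue_rest n z - gue_rest n w) \<le> C * cmod (z - w)" using gue_rest_lipschitz by blast
  define E where "E = sqrt (8 * exp C)"
  define K where "K = 2 * C * exp C + 8 * E + 2 + C"
  have E0: "E \<ge> 0" by (simp add: E_def)
  have mgf: "gue_mgf n z = exp (of_real ((gue_sd n)\<^sup>2 / 2) * z\<^sup>2 + gue_rest n z)" if "gue_sd n \<ge> 1" "Re z \<ge> 0" for n z
  proof -
    have "ln (real n / 2) \<ge> 0"
    proof (rule ccontr)
      assume "\<not> ln (real n / 2) \<ge> 0"
      hence "gue_sd n \<le> 0" by (simp add: gue_sd_def)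
      thus False using that(1) by simp
    qed
    hence "(gue_sd n)\<^sup>2 / 2 = ln (real n / 2) / 4" by (simp add: gue_sd_def)
    hence e: "of_real ((gue_sd n)\<^sup>2 / 2) = complex_of_real (ln (real n / 2) / 4)" by (rule arg_cong)
    show ?thesis unfolding gue_mgf_eq_exp[OF that(2)] gue_rest_def e by simp
  qed
  have ratio: "gue_mgf n (Complex h \<tau>) / gue_mgf n (of_real h) =
      exp (\<i> * of_real ((gue_sd n)\<^sup>2 * h * \<tau>)) * of_real (exp (- ((gue_sd n)\<^sup>2 * \<tau>\<^sup>2) / 2)) * exp (gue_rest n (Complex h \<tau>) - gue_rest n (of_real h))"
    if n: "gue_sd n \<ge> 1" "h \<ge> 0" for n h \<tau>
  proof -
    have "gue_mgf n (Complex h \<tau>) / gue_mgf n (of_real h) =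
       exp ((of_real ((gue_sd n)\<^sup>2 / 2) * (Complex h \<tau>)\<^sup>2 + gue_rest n (Complex h \<tau>)) - (of_real ((gue_sd n)\<^sup>2 / 2) * (of_real h)\<^sup>2 + gue_rest n (of_real h)))"
      using mgf[OF n(1), of "Complex h \<tau>"] mgf[OF n(1), of "of_real h"] n(2) by (simp only: exp_diff) simp
    also have "(of_real ((gue_sd n)\<^sup>2 / 2) * (Complex h \<tau>)\<^sup>2 + gue_rest n (Complex h \<tau>)) - (of_real ((gue_sd n)\<^sup>2 / 2) * (of_real h)\<^sup>2 + gue_rest n (of_real h))
       = \<i> * of_real ((gue_sd n)\<^sup>2 * h * \<tau>) + of_real (- ((gue_sd n)\<^sup>2 * \<tau>\<^sup>2) / 2) + (gue_rest n (Complex h \<tau>) - gue_rest n (of_real h))"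
      by (simp add: complex_eq_iff power2_eq_square field_simps)
    finally show ?thesis by (simp only: exp_add exp_of_real)
  qed
  show ?thesis
  proof (rule that[of K])
    show "K \<ge> 0" using C(1) E0 by (simp add: K_def)
    fix n :: nat and h :: real
    assume n: "n \<ge> 1" and s: "gue_sd n \<ge> 1" and h: "0 \<le> h" "h \<le> 1"
    have hd: "of_real h \<in> half_disc" "0 \<in> half_disc"
      using half_disc_Complex[OF h, of 0] by (auto simp: complex_of_real_def half_disc_def)
    show "\<exists>G. cmod G \<le> K * h \<and> gue_mgf n (of_real h) * of_real (exp (- (h * gue_sd n)\<^sup>2 / 2)) = exp G"
    proof (intro exI[of _ "gue_rest n (of_real h)"] conjI)
      have "cmod (gue_rest n (of_real h) - gue_rest n 0) \<le> C * cmod (of_real h - 0)" by (rule C(2)[OF n hd])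
      hence "cmod (gue_rest n (of_real h)) \<le> C * h" using h by (simp add: gue_rest_0)
      also have "\<dots> \<le> K * h" using h C(1) E0 by (intro mult_right_mono) (auto simp: K_def)
      finally show "cmod (gue_rest n (of_real h)) \<le> K * h" .
      have "gue_mgf n (of_real h) * of_real (exp (- (h * gue_sd n)\<^sup>2 / 2)) =
         exp (of_real ((gue_sd n)\<^sup>2 / 2) * (of_real h)\<^sup>2 + gue_rest n (of_real h)) * exp (of_real (- (h * gue_sd n)\<^sup>2 / 2))"
        unfolding exp_of_real using mgf[OF s, of "of_real h"] h by simp
      also have "\<dots> = exp (gue_rest n (of_real h))"
        unfolding exp_add[symmetric] by (simp add: power_mult_distrib)
      finally show "gue_mgf n (of_real h) * of_real (exp (- (h * gue_sd n)\<^sup>2 / 2)) = exp (gue_rest n (of_real h))" .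
    qed
    fix t :: real
    define s where "s = gue_sd n"
    have s1: "s \<ge> 1" using s by (simp add: s_def)
    define \<phi> where "\<phi> = gue_mgf n (Complex h (t / s)) / gue_mgf n (of_real h) * iexp (- (t * h * s))"
    have goal: "cmod (\<phi> - of_real (exp (- t\<^sup>2 / 2))) \<le> K / s * \<bar>t\<bar> / (1 + t\<^sup>2)"
    proof (cases "\<bar>t\<bar> \<le> s")
      case True
      define D where "D = gue_rest n (Complex h (t / s)) - gue_rest n (of_real h)"
      have ts: "\<bar>t / s\<bar> \<le> 1" using True s1 by (simp add: abs_mult)
      have "cmod D \<le> C * cmod (Complex h (t / s) - of_real h)"
        unfolding D_def by (rule C(2)[OF n half_disc_Complex[OF h ts] hd(1)])
      also have "Complex h (t / s) - of_real h = \<i> * of_real (t / s)" by (simp add: complex_eq_iff)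
      also have "cmod (\<i> * of_real (t / s)) = \<bar>t\<bar> / s" using s1 by (simp add: norm_mult norm_divide)
      finally have D: "cmod D \<le> C * (\<bar>t\<bar> / s)" .
      have D': "cmod D \<le> C" using D mult_left_mono[of "\<bar>t\<bar> / s" 1 C] ts C(1) s1 by simp
      have e1: "(gue_sd n)\<^sup>2 * h * (t / s) = t * h * s" "- ((gue_sd n)\<^sup>2 * (t / s)\<^sup>2) / 2 = - t\<^sup>2 / 2"
        using s1 by (simp_all add: s_def[symmetric] power2_eq_square field_simps)
      have "\<phi> = (exp (\<i> * of_real (t * h * s)) * iexp (- (t * h * s))) * of_real (exp (- t\<^sup>2 / 2)) * exp D"
        unfolding \<phi>_def ratio[OF s h(1)] e1 D_def[symmetric] by (simp only: mult_ac)
      also have "exp (\<i> * of_real (t * h * s)) * iexp (- (t * h * s)) = 1"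
        by (simp add: exp_add[symmetric])
      finally have "\<phi> - of_real (exp (- t\<^sup>2 / 2)) = of_real (exp (- t\<^sup>2 / 2)) * (exp D - 1)"
        by (simp add: algebra_simps)
      hence "cmod (\<phi> - of_real (exp (- t\<^sup>2 / 2))) = exp (- t\<^sup>2 / 2) * cmod (exp D - 1)"
        by (simp only: norm_mult norm_of_real abs_exp_cancel)
      also have "\<dots> \<le> 2 / (1 + t\<^sup>2) * ((C * (\<bar>t\<bar> / s)) * exp C)"
      proof (intro mult_mono exp_minus_half_square_le)
        have "cmod (exp D - 1) \<le> cmod D * exp (cmod D)" by (rule norm_exp_minus_1_le)
        also have "\<dots> \<le> (C * (\<bar>t\<bar> / s)) * exp C" using D D' C(1) s1 by (intro mult_mono) auto
        finally show "cmod (exp D - 1) \<le> (C * (\<bar>t\<bar> / s)) * exp C" .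
      qed (auto simp: add_pos_nonneg)
      also have "\<dots> = (2 * C * exp C) * (\<bar>t\<bar> / s / (1 + t\<^sup>2))" by (simp add: mult_ac)
      also have "\<dots> \<le> K * (\<bar>t\<bar> / s / (1 + t\<^sup>2))"
        using C(1) E0 s1 by (intro mult_right_mono) (auto simp: K_def add_pos_nonneg)
      finally show ?thesis by simp
    next
      case False
      hence t: "\<bar>t\<bar> > s" "\<bar>t\<bar> \<ge> 1" "t \<noteq> 0" using s1 by auto
      have t2: "t\<^sup>2 \<ge> 1" using t(2) by (metis abs_le_square_iff abs_one one_power2)
      let ?m0 = "cmod (gue_mgf n (of_real h))"
      have m0: "?m0 > 0" using mgf[OF s, of "of_real h"] h by simp
      define r where "r = cmod (gue_mgf n (Complex h (t / s))) / ?m0"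
      have r0: "r \<ge> 0" by (simp add: r_def)
      have r1: "r \<le> 8 / (t / s)\<^sup>2"
        using norm_gue_mgf_decay[OF n h, of "t / s"] t s1 m0 by (simp add: r_def divide_simps split: if_splits)
      have "r \<le> cmod (gue_mgf n (Complex h 1)) / ?m0"
        unfolding r_def using t s1 h by (intro divide_right_mono norm_gue_mgf_antimono) (auto simp: abs_mult)
      also have "\<dots> = cmod (gue_mgf n (Complex h 1) / gue_mgf n (of_real h))" by (simp add: norm_divide)
      also have "\<dots> = exp (- s\<^sup>2 / 2) * cmod (exp (gue_rest n (Complex h 1) - gue_rest n (of_real h)))"
        unfolding ratio[OF s h(1)] by (simp add: norm_mult s_def)
      also have "\<dots> \<le> exp (- s\<^sup>2 / 2) * exp C"
      proof (rule mult_left_mono)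
        have "cmod (gue_rest n (Complex h 1) - gue_rest n (of_real h)) \<le> C * cmod (Complex h 1 - of_real h)"
          by (rule C(2)[OF n half_disc_Complex[OF h] hd(1)]) simp
        also have "Complex h 1 - of_real h = \<i>" by (simp add: complex_eq_iff)
        finally have "cmod (gue_rest n (Complex h 1) - gue_rest n (of_real h)) \<le> C" by simp
        thus "cmod (exp (gue_rest n (Complex h 1) - gue_rest n (of_real h))) \<le> exp C"
          by (intro order_trans[OF norm_exp]) auto
      qed simp
      finally have r2: "r \<le> exp (- s\<^sup>2 / 2) * exp C" .
      have "r\<^sup>2 \<le> (8 / (t / s)\<^sup>2) * (exp (- s\<^sup>2 / 2) * exp C)"
        unfolding power2_eq_square using r0 r1 r2 by (intro mult_mono) (auto simp: power2_eq_square)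
      also have "\<dots> = (E * exp (- s\<^sup>2 / 4) * (s / \<bar>t\<bar>))\<^sup>2"
      proof -
        have "exp (- s\<^sup>2 / 2) = (exp (- s\<^sup>2 / 4))\<^sup>2" by (simp add: power2_eq_square flip: exp_add)
        moreover have "E\<^sup>2 = 8 * exp C" by (simp add: E_def)
        ultimately show ?thesis by (simp add: power_mult_distrib power_divide)
      qed
      finally have r: "r \<le> E * exp (- s\<^sup>2 / 4) * (s / \<bar>t\<bar>)"
        by (rule power2_le_imp_le) (use E0 s1 in auto)
      have "s\<^sup>2 / 4 \<le> exp (s\<^sup>2 / 4)" using exp_ge_add_one_self[of "s\<^sup>2 / 4"] by linarith
      hence "s\<^sup>2 * exp (- s\<^sup>2 / 4) \<le> 4" by (simp add: exp_minus field_simps)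
      hence es: "exp (- s\<^sup>2 / 4) * s \<le> 4 / s" using s1 by (simp add: field_simps power2_eq_square)
      have inv_t: "1 / \<bar>t\<bar> \<le> 2 * (\<bar>t\<bar> / (1 + t\<^sup>2))"
      proof -
        have "1 + t\<^sup>2 \<le> 2 * t\<^sup>2" using t2 by simp
        also have "2 * t\<^sup>2 = 2 * (\<bar>t\<bar> * \<bar>t\<bar>)" by (simp add: power2_eq_square)
        finally show ?thesis using t(3) by (simp add: field_simps add_pos_nonneg)
      qed
      have "r \<le> E * ((exp (- s\<^sup>2 / 4) * s) * (1 / \<bar>t\<bar>))" using r by (simp add: mult_ac)
      also have "\<dots> \<le> E * ((4 / s) * (2 * (\<bar>t\<bar> / (1 + t\<^sup>2))))"
        using es inv_t E0 s1 by (intro mult_left_mono mult_mono) auto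
      finally have rb: "r \<le> 8 * E * (\<bar>t\<bar> / s / (1 + t\<^sup>2))" by (simp add: mult_ac)
      have gb: "exp (- t\<^sup>2 / 2) \<le> 2 * (\<bar>t\<bar> / s / (1 + t\<^sup>2))"
      proof -
        have "exp (- t\<^sup>2 / 2) \<le> 2 / (1 + t\<^sup>2) * 1" using exp_minus_half_square_le[of t] by simp
        also have "\<dots> \<le> 2 / (1 + t\<^sup>2) * (\<bar>t\<bar> / s)"
          using t s1 by (intro mult_left_mono) (auto simp: add_pos_nonneg)
        finally show ?thesis by (simp add: mult_ac)
      qed
      have "cmod \<phi> = r" by (simp add: \<phi>_def r_def norm_mult norm_divide norm_exp_eq_Re)
      hence "cmod (\<phi> - of_real (exp (- t\<^sup>2 / 2))) \<le> r + exp (- t\<^sup>2 / 2)"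
        using norm_triangle_ineq4[of \<phi> "of_real (exp (- t\<^sup>2 / 2))"] by simp
      also have "\<dots> \<le> (8 * E + 2) * (\<bar>t\<bar> / s / (1 + t\<^sup>2))" using add_mono[OF rb gb] unfolding distrib_right .
      also have "\<dots> \<le> K * (\<bar>t\<bar> / s / (1 + t\<^sup>2))"
        using C(1) s1 by (intro mult_right_mono) (auto simp: K_def add_pos_nonneg)
      finally show ?thesis by simp
    qed
    have "complex_of_real (exp (- t\<^sup>2 / 2)) = exp (- (of_real t)\<^sup>2 / 2)" by (simp flip: exp_of_real)
    with goal show "cmod (gue_mgf n (Complex h (t / gue_sd n)) / gue_mgf n (of_real h) * iexp (- (t * h * gue_sd n)) - exp (- (of_real t)\<^sup>2 / 2))
        \<le> K / gue_sd n * \<bar>t\<bar> / (1 + t\<^sup>2)" by (simp only: \<phi>_def s_def)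
  qed
qed

section \<open>From characteristic functions to distribution functions\<close>

lemma integral_inverse_1_plus_square_real:
  shows "integrable lborel (\<lambda>t::real. 1 / (1 + t\<^sup>2))" "(\<integral>t. 1 / (1 + t\<^sup>2) \<partial>lborel) = pi"
proof -
  have e: "einterval (-\<infinity>) \<infinity> = UNIV" by (auto simp: einterval_def)
  show "integrable lborel (\<lambda>t::real. 1 / (1 + t\<^sup>2))"
    using integrable_inverse_1_plus_square by (simp add: set_integrable_def inverse_eq_divide)
  show "(\<integral>t. 1 / (1 + t\<^sup>2) \<partial>lborel) = pi"
    using LBINT_inverse_1_plus_square
    by (simp add: interval_lebesgue_integral_def set_lebesgue_integral_def inverse_eq_divide)
qed

text \<open>
  In the inversion formula the kernel has modulus at most \<open>2 / |t|\<close>, so the assumed bound leaves the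
  integrand \<open>2 \<epsilon> / (1 + t\<^sup>2)\<close>, whose integral \<open>2 \<pi> \<epsilon>\<close> is matched by the prefactor \<open>1 / (2 \<pi>)\<close>.
\<close>

lemma char_close_imp_interval_close:
  assumes P: "real_distribution P" and Q: "real_distribution Q"
    and close: "\<And>t. cmod (char P t - char Q t) \<le> \<epsilon> * \<bar>t\<bar> / (1 + t\<^sup>2)"
    and ab: "a \<le> b" and atoms: "measure P {a} = 0" "measure P {b} = 0" "measure Q {a} = 0" "measure Q {b} = 0"
  shows "\<bar>measure P {a<..b} - measure Q {a<..b}\<bar> \<le> \<epsilon>"
proof -
  interpret P: real_distribution P by fact
  interpret Q: real_distribution Q by fact
  have "0 \<le> cmod (char P 1 - char Q 1)" by simp
  also note close[of 1]
  finally have eps: "0 \<le> \<epsilon>" by simp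
  let ?F = "\<lambda>t. (iexp (-(t * a)) - iexp (-(t * b))) / (\<i> * t)"
  have F_bd: "cmod (?F t) \<le> b - a" if "t \<noteq> 0" for t
    using Levy_Inversion_aux2[of "-b" "-a" t] ab that by simp
  have F_bd2: "cmod (?F t) \<le> 2 / \<bar>t\<bar>" for t
  proof -
    have "cmod (iexp (-(t * a)) - iexp (-(t * b))) \<le> 1 + 1"
      by (rule order_trans[OF norm_triangle_ineq4]) (intro add_mono, auto simp: norm_exp_eq_Re)
    thus ?thesis by (simp add: norm_divide norm_mult divide_right_mono)
  qed
  have int: "integrable lborel (\<lambda>t. indicator {-T<..<T} t *\<^sub>R (?F t * char R t))"
    if R: "real_distribution R" for T R
  proof -
    interpret R: real_distribution R by fact
    show ?thesis
    proof (rule integrableI_bounded_set_indicator[where B="b - a"])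
      show "AE t in lborel. t \<in> {-T<..<T} \<longrightarrow> cmod (?F t * char R t) \<le> b - a"
      proof (intro AE_I[of _ _ "{0}"])
        show "{t \<in> space lborel. \<not> (t \<in> {-T<..<T} \<longrightarrow> cmod (?F t * char R t) \<le> b - a)} \<subseteq> {0}"
        proof (intro subsetI, rule ccontr)
          fix t assume t: "t \<in> {t \<in> space lborel. \<not> (t \<in> {-T<..<T} \<longrightarrow> cmod (?F t * char R t) \<le> b - a)}"
            and "t \<notin> {0}"
          have "cmod (?F t * char R t) \<le> (b - a) * 1"
            unfolding norm_mult using F_bd[of t] R.cmod_char_le_1[of t] \<open>t \<notin> {0}\<close> ab
            by (intro mult_mono) auto
          with t show False by simp
        qed
      qed auto
      show "(\<lambda>t. ?F t * char R t) \<in> borel_measurable lborel"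
        by (simp add: R.char_measurable)
      show "emeasure lborel {-T<..<T} < \<infinity>" by (cases "-T \<le> T") auto
    qed simp
  qed
  let ?I = "\<lambda>R T. 1 / (2 * pi) * (CLBINT t=-T..T. ?F t * char R t)"
  have bd: "cmod (?I P T - ?I Q T) \<le> \<epsilon>" if "T \<ge> 0" for T :: real
  proof -
    have eq: "(CLBINT t=-T..T. ?F t * char R t) = (\<integral>t. indicator {-T<..<T} t *\<^sub>R (?F t * char R t) \<partial>lborel)" for R
      using that by (simp add: interval_lebesgue_integral_def set_lebesgue_integral_def)
    have "?I P T - ?I Q T = 1 / (2 * pi) * ((CLBINT t=-T..T. ?F t * char P t) - (CLBINT t=-T..T. ?F t * char Q t))"
      by (simp add: right_diff_distrib)
    also have "\<dots> = 1 / (2 * pi) * (\<integral>t. indicator {-T<..<T} t *\<^sub>R (?F t * char P t) - indicator {-T<..<T} t *\<^sub>R (?F t * char Q t) \<partial>lborel)"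
      unfolding eq by (subst Bochner_Integration.integral_diff[OF int[OF P] int[OF Q]]) simp
    finally have norm_eq: "cmod (?I P T - ?I Q T) = 1 / (2 * pi) * cmod (\<integral>t. indicator {-T<..<T} t *\<^sub>R (?F t * char P t) - indicator {-T<..<T} t *\<^sub>R (?F t * char Q t) \<partial>lborel)"
      by (simp add: norm_mult norm_divide)
    have "cmod (\<integral>t. indicator {-T<..<T} t *\<^sub>R (?F t * char P t) - indicator {-T<..<T} t *\<^sub>R (?F t * char Q t) \<partial>lborel)
       \<le> (\<integral>t. cmod (indicator {-T<..<T} t *\<^sub>R (?F t * char P t) - indicator {-T<..<T} t *\<^sub>R (?F t * char Q t)) \<partial>lborel)"
      by (rule integral_norm_bound)
    also have "\<dots> \<le> (\<integral>t. 2 * \<epsilon> * (1 / (1 + t\<^sup>2)) \<partial>lborel)"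
    proof (rule integral_mono)
      show "integrable lborel (\<lambda>t. cmod (indicator {-T<..<T} t *\<^sub>R (?F t * char P t) - indicator {-T<..<T} t *\<^sub>R (?F t * char Q t)))"
        using int[OF P] int[OF Q] by auto
      show "integrable lborel (\<lambda>t::real. 2 * \<epsilon> * (1 / (1 + t\<^sup>2)))"
        using integral_inverse_1_plus_square_real(1) by (rule integrable_mult_right)
      fix t :: real
      have "cmod (indicator {-T<..<T} t *\<^sub>R (?F t * char P t) - indicator {-T<..<T} t *\<^sub>R (?F t * char Q t))
         = cmod (indicator {-T<..<T} t *\<^sub>R (?F t * (char P t - char Q t)))"
        by (simp add: scaleR_diff_right right_diff_distrib)
      also have "\<dots> \<le> cmod (?F t) * cmod (char P t - char Q t)"
        by (auto simp: indicator_def norm_mult norm_divide)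
      also have "\<dots> \<le> 2 / \<bar>t\<bar> * (\<epsilon> * \<bar>t\<bar> / (1 + t\<^sup>2))"
        by (rule mult_mono[OF F_bd2 close]) auto
      also have "\<dots> \<le> 2 * \<epsilon> * (1 / (1 + t\<^sup>2))"
        using eps by (cases "t = 0") (auto simp: field_simps)
      finally show "cmod (indicator {-T<..<T} t *\<^sub>R (?F t * char P t) - indicator {-T<..<T} t *\<^sub>R (?F t * char Q t)) \<le> 2 * \<epsilon> * (1 / (1 + t\<^sup>2))" .
    qed
    also have "\<dots> = 2 * \<epsilon> * pi"
      by (subst integral_mult_right_zero) (simp only: integral_inverse_1_plus_square_real(2))
    finally have "1 / (2 * pi) * cmod (\<integral>t. indicator {-T<..<T} t *\<^sub>R (?F t * char P t) - indicator {-T<..<T} t *\<^sub>R (?F t * char Q t) \<partial>lborel)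
        \<le> 1 / (2 * pi) * (2 * \<epsilon> * pi)"
      by (rule mult_left_mono) simp
    thus ?thesis unfolding norm_eq by simp
  qed
  have "(\<lambda>n. ?I P (real n) - ?I Q (real n)) \<longlonglongrightarrow> of_real (measure P {a<..b}) - of_real (measure Q {a<..b})"
    using tendsto_diff[OF P.Levy_Inversion[OF ab atoms(1,2)] Q.Levy_Inversion[OF ab atoms(3,4)]] by simp
  hence "(\<lambda>n. cmod (?I P (real n) - ?I Q (real n))) \<longlonglongrightarrow> cmod (of_real (measure P {a<..b}) - of_real (measure Q {a<..b}))"
    by (rule tendsto_norm)
  hence "cmod (of_real (measure P {a<..b}) - of_real (measure Q {a<..b})) \<le> \<epsilon>"
    by (rule LIMSEQ_le_const2) (use bd in auto)
  thus ?thesis by (simp flip: of_real_diff)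
qed

text \<open>
  Let the left end of the interval tend to \<open>-\<infinity>\<close> and the right end decrease to \<open>x\<close>, both avoiding the
  countably many atoms.
\<close>

lemma char_close_imp_cdf_close:
  assumes P: "real_distribution P" and Q: "real_distribution Q"
    and close: "\<And>t. cmod (char P t - char Q t) \<le> \<epsilon> * \<bar>t\<bar> / (1 + t\<^sup>2)"
  shows "\<bar>cdf P x - cdf Q x\<bar> \<le> \<epsilon>"
proof (rule field_le_epsilon)
  fix \<delta> :: real assume \<delta>: "\<delta> > 0"
  interpret P: real_distribution P by fact
  interpret Q: real_distribution Q by fact
  \<comment> \<open>a point that is no atom of either law exists in every open interval\<close>
  have count: "countable {x. measure P {x} \<noteq> 0 \<or> measure Q {x} \<noteq> 0}"
    using countable_Un[OF P.countable_support Q.countable_support] by (simp add: Un_def)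
  let ?D = "\<lambda>x. cdf P x - cdf Q x"
  have "(?D \<longlongrightarrow> 0) at_bot"
    using P.cdf_lim_at_bot Q.cdf_lim_at_bot by (intro tendsto_eq_intros) auto
  hence "eventually (\<lambda>y. \<bar>?D y\<bar> < \<delta> / 2 \<and> y \<le> x) at_bot"
    using \<delta> by (simp only: tendsto_iff dist_real_def diff_0_right eventually_conj eventually_le_at_bot half_gt_zero)
  then obtain M where "\<And>y. y \<le> M \<Longrightarrow> \<bar>?D y\<bar> < \<delta> / 2" "M \<le> x"
    unfolding eventually_at_bot_linorder by auto
  with open_minus_countable[OF count, of "{..< M}"] obtain a where
    a: "measure P {a} = 0" "measure Q {a} = 0" "a \<le> x" "\<bar>?D a\<bar> < \<delta> / 2" by auto
  have "(?D \<longlongrightarrow> ?D x) (at_right x)"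
    using P.cdf_is_right_cont[of x] Q.cdf_is_right_cont[of x]
    by (intro tendsto_intros) (auto simp add: continuous_within)
  hence "eventually (\<lambda>y. \<bar>?D y - ?D x\<bar> < \<delta> / 2) (at_right x)"
    using \<delta> by (simp only: tendsto_iff dist_real_def eventually_conj eventually_at_right_less half_gt_zero)
  then obtain N where "N > x" "\<And>y. x < y \<Longrightarrow> y < N \<Longrightarrow> \<bar>?D y - ?D x\<bar> < \<delta> / 2"
    by (auto simp add: eventually_at_right[OF less_add_one])
  with open_minus_countable[OF count, of "{x <..< N}"] obtain b where
    b: "x < b" "measure P {b} = 0" "measure Q {b} = 0" "\<bar>?D b - ?D x\<bar> < \<delta> / 2"
    by (auto simp: abs_minus_commute)
  have "a < b" using a b by linarith
  have "\<bar>measure P {a<..b} - measure Q {a<..b}\<bar> \<le> \<epsilon>"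
    by (rule char_close_imp_interval_close[OF P Q close]) (use a b \<open>a < b\<close> in auto)
  hence "\<bar>?D b - ?D a\<bar> \<le> \<epsilon>"
    unfolding P.cdf_diff_eq[OF \<open>a < b\<close>, symmetric] Q.cdf_diff_eq[OF \<open>a < b\<close>, symmetric]
    by (simp add: algebra_simps)
  thus "\<bar>?D x\<bar> \<le> \<epsilon> + \<delta>" using a b by linarith
qed

lemma cdf_close_imp_lessThan_close:
  assumes P: "real_distribution P" and Q: "real_distribution Q"
    and close: "\<And>x. \<bar>cdf P x - cdf Q x\<bar> \<le> \<epsilon>"
  shows "\<bar>measure P {..<x} - measure Q {..<x}\<bar> \<le> \<epsilon>"
proof -
  interpret P: real_distribution P by fact
  interpret Q: real_distribution Q by fact
  have "((\<lambda>y. \<bar>cdf P y - cdf Q y\<bar>) \<longlongrightarrow> \<bar>measure P {..<x} - measure Q {..<x}\<bar>) (at_left x)"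
    by (intro tendsto_intros P.cdf_at_left Q.cdf_at_left)
  thus ?thesis
    by (rule tendsto_upperbound) (use close in auto)
qed

lemma cdf_close_imp_atLeast_close:
  assumes P: "real_distribution P" and Q: "real_distribution Q"
    and close: "\<And>x. \<bar>cdf P x - cdf Q x\<bar> \<le> \<epsilon>"
  shows "\<bar>measure P {x..} - measure Q {x..}\<bar> \<le> \<epsilon>"
proof -
  interpret P: real_distribution P by fact
  interpret Q: real_distribution Q by fact
  have "measure R {x..} = 1 - measure R {..<x}" if R: "real_distribution R" for R
  proof -
    interpret R: real_distribution R by fact
    have "{x..} = space R - {..<x}" by auto
    thus ?thesis using R.prob_compl[of "{..<x}"] by simp
  qed
  from this[OF P] this[OF Q] show ?thesis
    using cdf_close_imp_lessThan_close[OF P Q close, of x] by linarith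
qed

lemma cdf_close_imp_atLeastAtMost_close:
  assumes P: "real_distribution P" and Q: "real_distribution Q"
    and close: "\<And>x. \<bar>cdf P x - cdf Q x\<bar> \<le> \<epsilon>" and "x \<le> z"
  shows "\<bar>measure P {x..z} - measure Q {x..z}\<bar> \<le> 2 * \<epsilon>"
proof -
  have "measure R {x..z} = cdf R z - measure R {..<x}" if R: "real_distribution R" for R
  proof -
    interpret R: real_distribution R by fact
    have "{..z} = {..<x} \<union> {x..z}" "{..<x} \<inter> {x..z} = {}" using \<open>x \<le> z\<close> by auto
    thus ?thesis using R.finite_measure_Union[of "{..<x}" "{x..z}"] by (simp add: cdf_def ivl_disj_int)
  qed
  from this[OF P] this[OF Q] show ?thesis
    using cdf_close_imp_lessThan_close[OF P Q close, of x] close[of z] by linarith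
qed

text \<open>
  The Laplace transform of the restriction to the half line \<open>u \<ge> 0\<close>.
\<close>

definition half_laplace :: "real measure \<Rightarrow> real \<Rightarrow> real" where
  "half_laplace R y = (\<integral>u. indicator {0..} u * exp (- y * u) \<partial>R)"

text \<open>
  The function \<open>exp (- y u)\<close> on \<open>u \<ge> 0\<close> is a mixture of indicators of intervals starting at 0.
  Hence closeness on intervals passes to the integrals with the same constant.
\<close>

lemma half_laplace_layer_cake:
  assumes R: "real_distribution R" and y: "y \<ge> 0"
  shows "integrable lborel (\<lambda>v. indicator {0<..1} v * measure R {u. 0 \<le> u \<and> v \<le> exp (- y * u)})"
    and "half_laplace R y = (\<integral>v. indicator {0<..1} v * measure R {u. 0 \<le> u \<and> v \<le> exp (- y * u)} \<partial>lborel)"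
proof -
  interpret R: real_distribution R by fact
  interpret pair_sigma_finite R lborel ..
  define A where "A = {p :: real \<times> real. 0 \<le> fst p \<and> 0 < snd p \<and> snd p \<le> exp (- y * fst p)}"
  have [measurable]: "A \<in> sets (borel \<Otimes>\<^sub>M borel)"
  proof -
    have "{p \<in> space (borel \<Otimes>\<^sub>M borel). 0 \<le> fst p \<and> 0 < snd p \<and> snd p \<le> exp (- y * fst p)} \<in> sets (borel \<Otimes>\<^sub>M (borel :: real measure))"
      by measurable
    thus ?thesis by (simp add: A_def space_pair_measure)
  qed
  have sets_pair: "sets (R \<Otimes>\<^sub>M lborel) = sets (borel \<Otimes>\<^sub>M borel)"
    by (intro sets_pair_measure_cong) auto
  have [measurable]: "A \<in> sets (R \<Otimes>\<^sub>M lborel)" by (simp add: sets_pair)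
  have A_sub: "A \<subseteq> UNIV \<times> {0<..1}"
  proof
    fix p assume "p \<in> A"
    hence p: "0 \<le> fst p" "0 < snd p" "snd p \<le> exp (- y * fst p)" by (auto simp: A_def)
    have "exp (- y * fst p) \<le> 1" using y p by (simp add: mult_nonneg_nonneg)
    hence "snd p \<le> 1" using p by linarith
    thus "p \<in> UNIV \<times> {0<..1}" using p by (cases p) auto
  qed
  have "emeasure (R \<Otimes>\<^sub>M lborel) (UNIV \<times> {0<..1::real}) = 1"
    by (subst lborel.emeasure_pair_measure_Times) (use R.emeasure_space_1 in auto)
  hence fin: "emeasure (R \<Otimes>\<^sub>M lborel) A < \<infinity>"
    using emeasure_mono[OF A_sub, of "R \<Otimes>\<^sub>M lborel"] by (simp add: le_less_trans sets_pair)
  have int: "integrable (R \<Otimes>\<^sub>M lborel) (case_prod (\<lambda>u v. indicator A (u, v) :: real))"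
    using integrable_real_indicator[OF \<open>A \<in> sets (R \<Otimes>\<^sub>M lborel)\<close> fin]
    by (simp add: case_prod_beta')
  have inner1: "(\<integral>u. indicat_real A (u, v) \<partial>R) = indicator {0<..1} v * measure R {u. 0 \<le> u \<and> v \<le> exp (- y * u)}" for v
  proof (cases "v \<in> {0<..1}")
    case True
    have "(\<integral>u. indicat_real A (u, v) \<partial>R) = (\<integral>u. indicator {u. 0 \<le> u \<and> v \<le> exp (- y * u)} u \<partial>R)"
      using True by (intro Bochner_Integration.integral_cong) (auto simp: A_def indicator_def)
    thus ?thesis using True by simp
  next
    case False
    hence "indicator A (u, v) = (0::real)" for u using A_sub by (auto simp: indicator_def)
    thus ?thesis using False by simp
  qed
  have inner2: "(\<integral>v. indicat_real A (u, v) \<partial>lborel) = indicator {0..} u * exp (- y * u)" for u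
  proof -
    have "(\<integral>v. indicat_real A (u, v) \<partial>lborel) = (\<integral>v. indicator {0..} u * indicator {0<..exp (- y * u)} v \<partial>lborel)"
      by (intro Bochner_Integration.integral_cong) (auto simp: A_def indicator_def)
    thus ?thesis by simp
  qed
  show "integrable lborel (\<lambda>v. indicator {0<..1} v * measure R {u. 0 \<le> u \<and> v \<le> exp (- y * u)})"
    using integrable_snd[OF int] by (simp only: inner1)
  show "half_laplace R y = (\<integral>v. indicator {0<..1} v * measure R {u. 0 \<le> u \<and> v \<le> exp (- y * u)} \<partial>lborel)"
    using Fubini_integral[OF int] unfolding half_laplace_def by (simp only: inner1 inner2)
qed

lemma cdf_close_imp_half_laplace_close:
  assumes P: "real_distribution P" and Q: "real_distribution Q"
    and close: "\<And>x. \<bar>cdf P x - cdf Q x\<bar> \<le> \<epsilon>" and y: "y \<ge> 0"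
  shows "\<bar>half_laplace P y - half_laplace Q y\<bar> \<le> 2 * \<epsilon>"
proof -
  have eps: "\<epsilon> \<ge> 0" using close[of 0] by linarith
  let ?S = "\<lambda>v. {u. 0 \<le> u \<and> v \<le> exp (- y * u)}"
  have S: "\<bar>measure P (?S v) - measure Q (?S v)\<bar> \<le> 2 * \<epsilon>" if v: "v \<in> {0<..1}" for v
  proof (cases "y = 0")
    case True
    hence "?S v = {0..}" using v by auto
    thus ?thesis using cdf_close_imp_atLeast_close[OF P Q close, of 0] eps by auto
  next
    case False
    have eq: "v \<le> exp (- y * u) \<longleftrightarrow> u \<le> - ln v / y" for u
    proof -
      have "v \<le> exp (- y * u) \<longleftrightarrow> ln v \<le> - y * u" using v ln_le_cancel_iff[of v "exp (- y * u)"] by simp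
      thus ?thesis using y False by (auto simp: field_simps)
    qed
    have "?S v = {0..- ln v / y}" unfolding eq by auto
    moreover have "0 \<le> - ln v / y" using v y by (intro divide_nonneg_nonneg) auto
    ultimately show ?thesis using cdf_close_imp_atLeastAtMost_close[OF P Q close, of 0 "- ln v / y"] by simp
  qed
  note i = half_laplace_layer_cake(1)[OF _ y]
  have "half_laplace P y - half_laplace Q y = 
     (\<integral>v. indicator {0<..1} v * measure P (?S v) - indicator {0<..1} v * measure Q (?S v) \<partial>lborel)"
    unfolding half_laplace_layer_cake(2)[OF P y] half_laplace_layer_cake(2)[OF Q y]
    by (rule Bochner_Integration.integral_diff[symmetric, OF i[OF P] i[OF Q]])
  hence "\<bar>half_laplace P y - half_laplace Q y\<bar> = 
     \<bar>\<integral>v. indicator {0<..1} v * measure P (?S v) - indicator {0<..1} v * measure Q (?S v) \<partial>lborel\<bar>"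
    by (rule arg_cong)
  also have "\<dots> \<le> (\<integral>v. \<bar>indicator {0<..1} v * measure P (?S v) - indicator {0<..1} v * measure Q (?S v)\<bar> \<partial>lborel)"
    by (rule integral_abs_bound)
  also have "\<dots> \<le> (\<integral>v. (2 * \<epsilon>) * indicator {0<..1::real} v \<partial>lborel)"
  proof (rule integral_mono)
    show "integrable lborel (\<lambda>v. \<bar>indicator {0<..1} v * measure P (?S v) - indicator {0<..1} v * measure Q (?S v)\<bar>)"
      using i[OF P] i[OF Q] by auto
    show "\<bar>indicator {0<..1} v * measure P (?S v) - indicator {0<..1} v * measure Q (?S v)\<bar> \<le> (2 * \<epsilon>) * indicator {0<..1} v" for v
      using S[of v] by (auto simp: indicator_def)
  qed auto
  also have "\<dots> = 2 * \<epsilon>" by simp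
  finally show ?thesis .
qed

section \<open>Exponential tilting of tail probabilities\<close>

text \<open>
  Cramer's change of measure, recentred and rescaled as if the law were Gaussian with variance \<open>s\<^sup>2\<close>,
  in which case the result is standard normal for every \<open>h\<close>.
\<close>

definition tilted :: "real measure \<Rightarrow> real \<Rightarrow> real \<Rightarrow> real measure" where
  "tilted \<mu> s h = distr (density \<mu> (\<lambda>x. ennreal (exp (h * x) / (\<integral>x. exp (h * x) \<partial>\<mu>)))) borel
     (\<lambda>x. (x - h * s\<^sup>2) / s)"

context
  fixes \<mu> :: "real measure" and s h :: real
  assumes \<mu>: "real_distribution \<mu>" and int: "integrable \<mu> (\<lambda>x. exp (h * x))" and s: "s > 0"
begin

lemma mgf_pos: "(\<integral>x. exp (h * x) \<partial>\<mu>) > 0"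
proof -
  interpret real_distribution \<mu> by fact
  have "(\<integral>x. exp (h * x) \<partial>\<mu>) \<noteq> 0"
    using integral_nonneg_eq_0_iff_AE[OF int] by (simp add: AE_False)
  moreover have "(\<integral>x. exp (h * x) \<partial>\<mu>) \<ge> 0" by (rule Bochner_Integration.integral_nonneg) simp
  ultimately show ?thesis by linarith
qed

lemma real_distribution_tilted: "real_distribution (tilted \<mu> s h)"
proof -
  interpret real_distribution \<mu> by fact
  let ?Z = "\<integral>x. exp (h * x) \<partial>\<mu>" 
  let ?D = "density \<mu> (\<lambda>x. ennreal (exp (h * x) / ?Z))"
  have "prob_space ?D"
  proof (rule prob_spaceI)
    have "emeasure ?D (space ?D) = (\<integral>\<^sup>+ x. ennreal (exp (h * x) / ?Z) \<partial>\<mu>)"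
      by (subst emeasure_density) (auto intro!: nn_integral_cong)
    also have "\<dots> = ennreal (\<integral>x. exp (h * x) / ?Z \<partial>\<mu>)"
      using mgf_pos by (intro nn_integral_eq_integral integrable_divide int) auto
    also have "(\<integral>x. exp (h * x) / ?Z \<partial>\<mu>) = 1" using mgf_pos by simp
    finally show "emeasure ?D (space ?D) = 1" by simp
  qed
  thus ?thesis unfolding tilted_def by (rule prob_space.real_distribution_distr) simp
qed

lemma char_tilted:
  "char (tilted \<mu> s h) t =
     (CLINT x|\<mu>. exp ((of_real h + \<i> * of_real (t / s)) * of_real x)) /
       of_real (\<integral>x. exp (h * x) \<partial>\<mu>) * iexp (- (t * h * s))"
proof -
  interpret real_distribution \<mu> by fact
  let ?Z = "\<integral>x. exp (h * x) \<partial>\<mu>" 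
  have "char (tilted \<mu> s h) t = (CLINT x|\<mu>. (exp (h * x) / ?Z) *\<^sub>R iexp (t * ((x - h * s\<^sup>2) / s)))"
    unfolding char_def tilted_def using mgf_pos
    by (subst integral_distr, simp, simp, subst integral_density) (auto intro!: AE_I2)
  also have "\<dots> = (CLINT x|\<mu>. exp ((of_real h + \<i> * of_real (t / s)) * of_real x) * (iexp (- (t * h * s)) / of_real ?Z))"
  proof (rule Bochner_Integration.integral_cong[OF refl])
    fix x
    have "t * ((x - h * s\<^sup>2) / s) = t / s * x - t * h * s"
      using s by (simp add: field_simps power2_eq_square)
    hence "iexp (t * ((x - h * s\<^sup>2) / s)) = exp (\<i> * of_real (t / s * x) + \<i> * of_real (- (t * h * s)))"
      by (simp only: ring_distribs(1)[symmetric] of_real_add[symmetric]) simp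
    hence "iexp (t * ((x - h * s\<^sup>2) / s)) = exp (\<i> * of_real (t / s * x)) * iexp (- (t * h * s))"
      by (simp only: exp_add)
    moreover have "exp ((of_real h + \<i> * of_real (t / s)) * of_real x) = of_real (exp (h * x)) * exp (\<i> * of_real (t / s * x))"
      by (simp add: exp_add[symmetric] algebra_simps exp_of_real[symmetric])
    ultimately show "(exp (h * x) / ?Z) *\<^sub>R iexp (t * ((x - h * s\<^sup>2) / s)) =
       exp ((of_real h + \<i> * of_real (t / s)) * of_real x) * (iexp (- (t * h * s)) / of_real ?Z)"
      by (simp add: scaleR_conv_of_real)
  qed
  also have "\<dots> = (CLINT x|\<mu>. exp ((of_real h + \<i> * of_real (t / s)) * of_real x)) * (iexp (- (t * h * s)) / of_real ?Z)"
    by (rule integral_mult_left_zero)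
  finally show ?thesis by simp
qed

lemma measure_atLeast_eq_half_laplace_tilted:
  "measure \<mu> {h * s\<^sup>2..} =
     (\<integral>x. exp (h * x) \<partial>\<mu>) * exp (- (h * s)\<^sup>2) * half_laplace (tilted \<mu> s h) (h * s)"
proof -
  interpret real_distribution \<mu> by fact
  let ?Z = "\<integral>x. exp (h * x) \<partial>\<mu>" 
  have "half_laplace (tilted \<mu> s h) (h * s) =
     (\<integral>x. (exp (h * x) / ?Z) *\<^sub>R (indicator {0..} ((x - h * s\<^sup>2) / s) * exp (- (h * s) * ((x - h * s\<^sup>2) / s))) \<partial>\<mu>)"
    unfolding half_laplace_def tilted_def using mgf_pos
    by (subst integral_distr, simp, simp, subst integral_density) (auto intro!: AE_I2)
  also have "\<dots> = (\<integral>x. (exp ((h * s)\<^sup>2) / ?Z) * indicator {h * s\<^sup>2..} x \<partial>\<mu>)"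
  proof (rule Bochner_Integration.integral_cong[OF refl])
    fix x
    have "- (h * s) * ((x - h * s\<^sup>2) / s) = (h * s)\<^sup>2 - h * x"
      using s by (simp add: field_simps power2_eq_square)
    hence "exp (h * x) * exp (- (h * s) * ((x - h * s\<^sup>2) / s)) = exp ((h * s)\<^sup>2)"
      by (simp add: exp_diff)
    moreover have "indicator {0..} ((x - h * s\<^sup>2) / s) = (indicator {h * s\<^sup>2..} x :: real)"
      using s by (auto simp: indicator_def zero_le_divide_iff)
    ultimately show "(exp (h * x) / ?Z) *\<^sub>R (indicator {0..} ((x - h * s\<^sup>2) / s) * exp (- (h * s) * ((x - h * s\<^sup>2) / s)))
       = (exp ((h * s)\<^sup>2) / ?Z) * indicator {h * s\<^sup>2..} x"
      by simp
  qed
  also have "\<dots> = exp ((h * s)\<^sup>2) / ?Z * measure \<mu> {h * s\<^sup>2..}" by simp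
  finally show ?thesis using mgf_pos by (simp add: exp_minus field_simps)
qed

end

text \<open>
  The substitution \<open>x = y + u\<close>; this is the Gaussian case of the tilting identity with \<open>s = 1\<close>.
\<close>

lemma std_normal_atLeast_eq_half_laplace:
  "measure std_normal_distribution {y..} = exp (- y\<^sup>2 / 2) * half_laplace std_normal_distribution y"
proof -
  have "measure std_normal_distribution {y..} = (\<integral>x. indicator {y..} x \<partial>std_normal_distribution)" by simp
  also have "\<dots> = (\<integral>x. std_normal_density x * indicator {y..} x \<partial>lborel)"
    by (subst integral_density) (auto intro!: AE_I2)
  also have "\<dots> = (\<integral>u. std_normal_density (y + u) * indicator {y..} (y + u) \<partial>lborel)"
    using lborel_integral_real_affine[of 1 "\<lambda>x. std_normal_density x * indicator {y..} x" y] by simp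
  also have "\<dots> = (\<integral>u. exp (- y\<^sup>2 / 2) * (std_normal_density u * (indicator {0..} u * exp (- y * u))) \<partial>lborel)"
  proof (rule Bochner_Integration.integral_cong[OF refl])
    fix u
    have "- (y + u)\<^sup>2 / 2 = - y\<^sup>2 / 2 + (- u\<^sup>2 / 2 + - y * u)"
      by (simp add: power2_eq_square field_simps)
    hence "exp (- (y + u)\<^sup>2 / 2) = exp (- y\<^sup>2 / 2) * (exp (- u\<^sup>2 / 2) * exp (- y * u))"
      by (simp only: exp_add)
    thus "std_normal_density (y + u) * indicator {y..} (y + u) = exp (- y\<^sup>2 / 2) * (std_normal_density u * (indicator {0..} u * exp (- y * u)))"
      by (auto simp: std_normal_density_def indicator_def)
  qed
  also have "\<dots> = exp (- y\<^sup>2 / 2) * (\<integral>u. std_normal_density u * (indicator {0..} u * exp (- y * u)) \<partial>lborel)"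
    by simp
  also have "(\<integral>u. std_normal_density u * (indicator {0..} u * exp (- y * u)) \<partial>lborel) = half_laplace std_normal_distribution y"
    unfolding half_laplace_def by (subst integral_density) (auto intro!: AE_I2)
  finally show ?thesis .
qed

text \<open>
  On \<open>[0, 1 / (1 + y)]\<close> both \<open>exp (- y u)\<close> and the density are bounded below.
\<close>

lemma half_laplace_std_normal_lower:
  assumes y: "y \<ge> 0"
  shows "half_laplace std_normal_distribution y \<ge> exp (-1) * std_normal_density 1 / (1 + y)"
proof -
  interpret real_distribution std_normal_distribution by (rule real_dist_normal_dist)
  let ?c = "exp (-1) * std_normal_density 1"
  have "?c / (1 + y) = (\<integral>u. ?c * indicator {0..1 / (1 + y)} u \<partial>lborel)" using y by simp
  also have "\<dots> \<le> (\<integral>u. std_normal_density u * (indicator {0..} u * exp (- y * u)) \<partial>lborel)"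
  proof (rule integral_mono)
    show "integrable lborel (\<lambda>u. ?c * indicator {0..1 / (1 + y)} u)"
      using y by (intro integrable_mult_right integrable_real_indicator) auto
    have "integrable std_normal_distribution (\<lambda>u. indicator {0..} u * exp (- y * u))"
      by (rule integrable_const_bound[where B=1]) (use y in \<open>auto simp: indicator_def\<close>)
    thus "integrable lborel (\<lambda>u. std_normal_density u * (indicator {0..} u * exp (- y * u)))"
      by (subst (asm) integrable_density) (auto intro!: AE_I2)
    fix u :: real
    show "?c * indicator {0..1 / (1 + y)} u \<le> std_normal_density u * (indicator {0..} u * exp (- y * u))"
    proof (cases "u \<in> {0..1 / (1 + y)}")
      case True
      have "u * (1 + y) \<le> 1" using True y by (simp add: field_simps)
      hence "u + y * u \<le> 1" by (simp add: algebra_simps)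
      moreover have "0 \<le> u" "0 \<le> y * u" using True y by auto
      ultimately have u: "y * u \<le> 1" "u \<le> 1" by linarith+
      have "u\<^sup>2 \<le> 1\<^sup>2" using u True by (intro power_mono) auto
      hence "std_normal_density 1 \<le> std_normal_density u"
        by (simp add: std_normal_density_def divide_right_mono)
      hence "std_normal_density 1 * exp (-1) \<le> std_normal_density u * exp (- y * u)"
        using u by (intro mult_mono) auto
      thus ?thesis using True by (simp add: mult.commute)
    qed auto
  qed
  also have "\<dots> = half_laplace std_normal_distribution y"
    unfolding half_laplace_def by (subst integral_density) (auto intro!: AE_I2)
  finally show ?thesis .
qed

text \<open>
  Both tails are written by means of \<open>half_laplace\<close>. The prefactors have the quotient \<open>R\<close>, and the two
  half line integrals differ by at most \<open>2 \<epsilon>\<close>, which is compared with the lower bound of order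
  \<open>1 / (1 + h s)\<close> for the Gaussian one.
\<close>

lemma tilted_tail_ratio:
  assumes \<mu>: "real_distribution \<mu>" and int: "integrable \<mu> (\<lambda>x. exp (h * x))" and s: "s > 0"
    and h: "h \<ge> 0"
    and close: "\<And>t. cmod (char (tilted \<mu> s h) t - exp (- (of_real t)\<^sup>2 / 2)) \<le> \<epsilon> * \<bar>t\<bar> / (1 + t\<^sup>2)"
  defines "R \<equiv> (\<integral>x. exp (h * x) \<partial>\<mu>) * exp (- (h * s)\<^sup>2 / 2)"
  shows "\<bar>measure \<mu> {h * s\<^sup>2..} / measure std_normal_distribution {h * s..} - R\<bar>
           \<le> R * (2 * \<epsilon> * (1 + h * s) / (exp (-1) * std_normal_density 1))"
proof -
  let ?N = std_normal_distribution
  let ?y = "h * s" and ?c = "exp (-1) * std_normal_density 1"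
  let ?A = "half_laplace ?N ?y" and ?B = "half_laplace (tilted \<mu> s h) ?y"
  have y: "?y \<ge> 0" using s h by simp
  have c: "?c > 0" by (simp add: std_normal_density_def)
  have A: "?A \<ge> ?c / (1 + ?y)" by (rule half_laplace_std_normal_lower[OF y])
  have cpos: "?c / (1 + ?y) > 0" using c y by simp
  hence A0: "?A > 0" using A by linarith
  have R0: "R > 0" using mgf_pos[OF \<mu> int s] by (simp add: R_def)
  have cdf: "\<bar>cdf (tilted \<mu> s h) x - cdf ?N x\<bar> \<le> \<epsilon>" for x
    by (rule char_close_imp_cdf_close[OF real_distribution_tilted[OF \<mu> int s] real_dist_normal_dist])
       (use close in \<open>simp add: char_std_normal_distribution exp_of_real[symmetric]\<close>)
  have BA: "\<bar>?B - ?A\<bar> \<le> 2 * \<epsilon>"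
    by (rule cdf_close_imp_half_laplace_close[OF real_distribution_tilted[OF \<mu> int s] real_dist_normal_dist cdf y])
  have "exp (- ?y\<^sup>2) = exp (- ?y\<^sup>2 / 2) * exp (- ?y\<^sup>2 / 2)" by (simp flip: exp_add)
  hence "measure \<mu> {h * s\<^sup>2..} / measure ?N {?y..} = R * (?B / ?A)"
    unfolding measure_atLeast_eq_half_laplace_tilted[OF \<mu> int s] std_normal_atLeast_eq_half_laplace R_def
    by simp
  hence "measure \<mu> {h * s\<^sup>2..} / measure ?N {?y..} - R = R * ((?B - ?A) / ?A)"
    using A0 by (simp add: field_simps)
  hence "\<bar>measure \<mu> {h * s\<^sup>2..} / measure ?N {?y..} - R\<bar> = R * (\<bar>?B - ?A\<bar> / ?A)"
    using R0 A0 by (simp add: abs_mult)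
  also have "\<bar>?B - ?A\<bar> / ?A \<le> 2 * \<epsilon> / (?c / (1 + ?y))"
    using BA A cpos by (intro frac_le) auto
  also have "\<dots> = 2 * \<epsilon> * (1 + ?y) / ?c" by simp
  finally show ?thesis using R0 by simp
qed

lemma untilted_tail_close:
  assumes \<mu>: "real_distribution \<mu>" and s: "s > 0"
    and close: "\<And>t. cmod (char (tilted \<mu> s 0) t - exp (- (of_real t)\<^sup>2 / 2)) \<le> \<epsilon> * \<bar>t\<bar> / (1 + t\<^sup>2)"
  shows "\<bar>measure \<mu> {y * s..} - measure std_normal_distribution {y..}\<bar> \<le> \<epsilon>"
proof -
  interpret real_distribution \<mu> by fact
  have int: "integrable \<mu> (\<lambda>x. exp (0 * x))" by simp
  have "tilted \<mu> s 0 = distr \<mu> borel (\<lambda>x. x / s)"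
    using prob_space by (simp add: tilted_def density_1)
  hence "measure (tilted \<mu> s 0) {y..} = measure \<mu> {y * s..}"
    using s by (simp add: measure_distr vimage_def field_simps atLeast_def)
  moreover have cdf: "\<bar>cdf (tilted \<mu> s 0) x - cdf std_normal_distribution x\<bar> \<le> \<epsilon>" for x
    by (rule char_close_imp_cdf_close[OF real_distribution_tilted[OF \<mu> int s] real_dist_normal_dist])
       (use close in \<open>simp add: char_std_normal_distribution exp_of_real[symmetric]\<close>)
  ultimately show ?thesis
    using cdf_close_imp_atLeast_close[OF real_distribution_tilted[OF \<mu> int s] real_dist_normal_dist cdf, of y] by simp
qed

section \<open>Moderate deviations of the log-determinant\<close>

theorem theorem4p6:
  fixes M :: "nat \<Rightarrow> 'a measure"
    and W :: "nat \<Rightarrow> 'a \<Rightarrow> complex mat"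
    and y :: "nat \<Rightarrow> real"
  assumes "\<And>n. n \<ge> 1 \<Longrightarrow> normalized_GUE (M n) n (W n)"
    and "y \<in> o(\<lambda>n. sqrt (ln (real n)))"
  shows "(\<lambda>n. \<P>(\<omega> in M n. log_det_centered n (W n \<omega>) \<ge> y n * sqrt (1/2 * ln (real n / 2))))
           \<sim>[sequentially]
         (\<lambda>n. \<P>(z in std_normal_distribution. z \<ge> y n))"
proof (rule asymp_equivI')
  let ?N = std_normal_distribution
  let ?P = "\<lambda>n. \<P>(\<omega> in M n. log_det_centered n (W n \<omega>) \<ge> y n * sqrt (1/2 * ln (real n / 2)))"
  let ?\<Phi> = "\<lambda>n. \<P>(z in std_normal_distribution. z \<ge> y n)"
  obtain K where K: "K \<ge> 0"
    "\<And>n h t. n \<ge> 1 \<Longrightarrow> gue_sd n \<ge> 1 \<Longrightarrow> 0 \<le> h \<Longrightarrow> h \<le> 1 \<Longrightarrow>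
      cmod (gue_mgf n (Complex h (t / gue_sd n)) / gue_mgf n (of_real h) * iexp (- (t * h * gue_sd n)) - exp (- (of_real t)\<^sup>2 / 2))
        \<le> K / gue_sd n * \<bar>t\<bar> / (1 + t\<^sup>2)"
    "\<And>n h. n \<ge> 1 \<Longrightarrow> gue_sd n \<ge> 1 \<Longrightarrow> 0 \<le> h \<Longrightarrow> h \<le> 1 \<Longrightarrow>
      \<exists>G. cmod G \<le> K * h \<and> gue_mgf n (of_real h) * of_real (exp (- (h * gue_sd n)\<^sup>2 / 2)) = exp G"
    using gue_tilted_char_close by metis
  define c where "c = exp (-1) * std_normal_density 1"
  have c: "c > 0" by (simp add: c_def std_normal_density_def)
  \<comment> \<open>collects the deviation of the tilted prefactor from 1 and the relative error of the half line integrals\<close>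
  define B where "B = K * exp K + (1 + K * exp K) * (2 * K / c)"
  have B2: "K / c \<le> B"
  proof -
    have "K / c \<le> 1 * (2 * K / c)" using K(1) c by (simp add: divide_right_mono)
    also have "\<dots> \<le> (1 + K * exp K) * (2 * K / c)" using K(1) c by (intro mult_right_mono) auto
    finally have "K / c \<le> (1 + K * exp K) * (2 * K / c)" .
    moreover have "0 \<le> K * exp K" using K(1) by simp
    ultimately show ?thesis unfolding B_def by linarith
  qed
  have ratio: "\<bar>?P n / ?\<Phi> n - 1\<bar> \<le> B * ((1 + \<bar>y n\<bar>) / gue_sd n)"
    if n: "n \<ge> 1" and s: "gue_sd n \<ge> 1" and ys: "\<bar>y n\<bar> \<le> gue_sd n" for n
  proof -
    define X where "X = (\<lambda>\<omega>. log_det_centered n (W n \<omega>))"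
    define \<mu> where "\<mu> = distr (M n) borel X"
    note G = assms(1)[OF n]
    note mgf = normalized_GUE_mgf[OF G, folded X_def]
    interpret Mn: prob_space "M n" by (rule mgf(1))
    note [measurable] = mgf(2)
    have \<mu>: "real_distribution \<mu>" unfolding \<mu>_def by (rule Mn.real_distribution_distr) measurable
    have int\<mu>: "integrable \<mu> (\<lambda>x. exp (z * of_real x))" and val\<mu>: "(CLINT x|\<mu>. exp (z * of_real x)) = gue_mgf n z"
      if "Re z \<ge> 0" for z
    proof -
      have "integrable (M n) (\<lambda>\<omega>. exp (z * of_real (X \<omega>)))" "(CLINT \<omega>|M n. exp (z * of_real (X \<omega>))) = gue_mgf n z"
        using mgf(3,4)[OF that] by (simp_all only: X_def)
      thus "integrable \<mu> (\<lambda>x. exp (z * of_real x))" "(CLINT x|\<mu>. exp (z * of_real x)) = gue_mgf n z"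
        unfolding \<mu>_def by (simp_all add: integrable_distr_eq integral_distr)
    qed
    have intR: "integrable \<mu> (\<lambda>x. exp (h * x))" and valR: "of_real (\<integral>x. exp (h * x) \<partial>\<mu>) = gue_mgf n (of_real h)"
      if "h \<ge> 0" for h :: real
    proof -
      have "integrable \<mu> (\<lambda>x. complex_of_real (exp (h * x)))"
        using int\<mu>[of "of_real h"] that by (simp add: exp_of_real[symmetric])
      thus "integrable \<mu> (\<lambda>x. exp (h * x))" by (simp only: complex_of_real_integrable_eq)
      show "of_real (\<integral>x. exp (h * x) \<partial>\<mu>) = gue_mgf n (of_real h)"
        using val\<mu>[of "of_real h"] that unfolding integral_complex_of_real[symmetric] by (simp add: exp_of_real[symmetric])
    qed
    have P: "?P n = measure \<mu> {y n * gue_sd n..}"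
    proof -
      have "X -` {y n * gue_sd n..} \<inter> space (M n) = {\<omega> \<in> space (M n). log_det_centered n (W n \<omega>) \<ge> y n * sqrt (1/2 * ln (real n / 2))}"
        by (auto simp: X_def gue_sd_def)
      thus ?thesis unfolding \<mu>_def by (subst measure_distr) auto
    qed
    have \<Phi>: "?\<Phi> n = measure ?N {y n..}" by (intro arg_cong[where f = "measure ?N"]) auto
    have close: "cmod (char (tilted \<mu> (gue_sd n) h) t - exp (- (of_real t)\<^sup>2 / 2)) \<le> K / gue_sd n * \<bar>t\<bar> / (1 + t\<^sup>2)"
      if h: "0 \<le> h" "h \<le> 1" for h t
    proof -
      have "of_real h + \<i> * of_real (t / gue_sd n) = Complex h (t / gue_sd n)" by (simp add: complex_eq_iff)
      hence "char (tilted \<mu> (gue_sd n) h) t = gue_mgf n (Complex h (t / gue_sd n)) / gue_mgf n (of_real h) * iexp (- (t * h * gue_sd n))"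
        using char_tilted[OF \<mu> intR[OF h(1)], of "gue_sd n" t] s val\<mu>[of "Complex h (t / gue_sd n)"] valR[OF h(1)] h
        by (simp only:) simp
      thus ?thesis using K(2)[OF n s h] by (simp only:)
    qed
    show ?thesis
    proof (cases "y n \<ge> 0")
      case True
      define h where "h = y n / gue_sd n"
      have h: "0 \<le> h" "h \<le> 1" "h * gue_sd n = y n" "h * (gue_sd n)\<^sup>2 = y n * gue_sd n"
        using True s ys by (auto simp: h_def power2_eq_square)
      define R where "R = (\<integral>x. exp (h * x) \<partial>\<mu>) * exp (- (h * gue_sd n)\<^sup>2 / 2)"
      obtain G where G: "cmod G \<le> K * h" "gue_mgf n (of_real h) * of_real (exp (- (h * gue_sd n)\<^sup>2 / 2)) = exp G"
        using K(3)[OF n s h(1,2)] by blast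
      have RG: "of_real R = exp G" unfolding R_def of_real_mult valR[OF h(1)] by (rule G(2))
      have "\<bar>R - 1\<bar> = cmod (exp G - 1)" unfolding RG[symmetric] by (metis norm_of_real of_real_1 of_real_diff)
      also have "\<dots> \<le> cmod G * exp (cmod G)" by (rule norm_exp_minus_1_le)
      also have "\<dots> \<le> (K * h) * exp K"
      proof (intro mult_mono)
        have "K * h \<le> K * 1" using K(1) h by (intro mult_left_mono) auto
        thus "exp (cmod G) \<le> exp K" using G(1) by simp
      qed (use G(1) K(1) h in auto)
      finally have R1: "\<bar>R - 1\<bar> \<le> K * exp K * h" by (simp add: mult_ac)
      also have "\<dots> \<le> K * exp K * 1" using K(1) h by (intro mult_left_mono) auto
      finally have R2: "R \<le> 1 + K * exp K" by linarith
      have "\<bar>?P n / ?\<Phi> n - R\<bar> \<le> R * (2 * (K / gue_sd n) * (1 + y n) / c)"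
        using tilted_tail_ratio[OF \<mu> intR[OF h(1)] _ h(1) close[OF h(1,2)]] s
        unfolding P \<Phi> h(3,4) R_def c_def by simp
      also have "\<dots> \<le> (1 + K * exp K) * (2 * (K / gue_sd n) * (1 + y n) / c)"
        using R2 True K(1) s c by (intro mult_right_mono) auto
      also have "\<dots> = (1 + K * exp K) * (2 * K / c) * ((1 + y n) / gue_sd n)"
        by (simp only: times_divide_eq_right times_divide_eq_left divide_divide_eq_left mult_ac)
      finally have A: "\<bar>?P n / ?\<Phi> n - R\<bar> \<le> (1 + K * exp K) * (2 * K / c) * ((1 + y n) / gue_sd n)" .
      have "K * exp K * h \<le> K * exp K * ((1 + y n) / gue_sd n)"
        using K(1) s by (intro mult_left_mono) (auto simp: h_def divide_right_mono)
      with A R1 have "\<bar>?P n / ?\<Phi> n - 1\<bar> \<le> B * ((1 + y n) / gue_sd n)"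
        unfolding B_def distrib_right by linarith
      thus ?thesis using True by simp
    next
      case False
      interpret N: real_distribution ?N by (rule real_dist_normal_dist)
      have PP: "\<bar>?P n - ?\<Phi> n\<bar> \<le> K / gue_sd n"
        unfolding P \<Phi> by (rule untilted_tail_close[OF \<mu> _ close]) (use s in auto)
      have "c \<le> half_laplace ?N 0" using half_laplace_std_normal_lower[of 0] by (simp add: c_def)
      also have "\<dots> = measure ?N {0..}" using std_normal_atLeast_eq_half_laplace[of 0] by simp
      also have "\<dots> \<le> measure ?N {y n..}" using False by (intro N.finite_measure_mono) auto
      finally have \<Phi>c: "c \<le> ?\<Phi> n" unfolding \<Phi> .
      hence \<Phi>0: "?\<Phi> n > 0" using c by linarith
      have "\<bar>?P n / ?\<Phi> n - 1\<bar> = \<bar>?P n - ?\<Phi> n\<bar> / ?\<Phi> n"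
        using \<Phi>0 by (simp add: diff_divide_distrib[symmetric] abs_divide field_simps)
      also have "\<dots> \<le> (K / gue_sd n) / c"
        using PP \<Phi>c c by (intro frac_le) auto
      also have "\<dots> = (K / c) * (1 / gue_sd n)" by simp
      also have "\<dots> \<le> B * ((1 + \<bar>y n\<bar>) / gue_sd n)"
        using B2 s K(1) c by (intro mult_mono divide_right_mono) (auto intro: order_trans[OF _ B2])
      finally show ?thesis .
    qed
  qed
  have sd: "(\<lambda>n. sqrt (ln (real n))) \<in> O(gue_sd)"
    unfolding gue_sd_def[abs_def] by real_asymp
  have y1: "(\<lambda>n. 1 + \<bar>y n\<bar>) \<in> o(gue_sd)"
  proof -
    have "(\<lambda>n. 1) \<in> o(\<lambda>n. sqrt (ln (real n)))" by real_asymp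
    moreover have "(\<lambda>n. \<bar>y n\<bar>) \<in> o(\<lambda>n. sqrt (ln (real n)))" using assms(2) by simp
    ultimately have "(\<lambda>n. 1 + \<bar>y n\<bar>) \<in> o(\<lambda>n. sqrt (ln (real n)))" by (rule sum_in_smallo)
    thus ?thesis using sd by (rule landau_o.small_big_trans)
  qed
  hence lim: "(\<lambda>n. (1 + \<bar>y n\<bar>) / gue_sd n) \<longlonglongrightarrow> 0" by (rule smalloD_tendsto)
  have ev_sd: "eventually (\<lambda>n. gue_sd n \<ge> 1) sequentially"
    unfolding gue_sd_def[abs_def] by real_asymp
  have ev_y: "eventually (\<lambda>n. (1 + \<bar>y n\<bar>) / gue_sd n < 1) sequentially"
    using order_tendstoD(2)[OF lim, of 1] by simp
  have bound: "eventually (\<lambda>n. norm (?P n / ?\<Phi> n - 1) \<le> B * ((1 + \<bar>y n\<bar>) / gue_sd n)) sequentially"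
    using ev_sd ev_y eventually_ge_at_top[of 1]
  proof eventually_elim
    case (elim n)
    have "\<bar>y n\<bar> \<le> gue_sd n" using elim by (simp add: field_simps)
    thus ?case using ratio[of n] elim by simp
  qed
  have "(\<lambda>n. B * ((1 + \<bar>y n\<bar>) / gue_sd n)) \<longlonglongrightarrow> B * 0" by (intro tendsto_intros lim)
  hence "(\<lambda>n. ?P n / ?\<Phi> n - 1) \<longlonglongrightarrow> 0" using bound by (intro Lim_null_comparison[OF bound]) simp
  thus "(\<lambda>n. ?P n / ?\<Phi> n) \<longlonglongrightarrow> 1" by (simp add: LIM_zero_iff)
qed

end
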